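(* Let $R$ be a Dedekind domain and let $A$ be a torsion-free $R$-module of finite rank. The following are equivalent: (a) $A$ is a self-pure-generator; (b) every pure submodule of $A$ of rank $1$ is $A$-generated; (c) $A$ has a quasi-direct summand $B$ of rank $1$ such that $\mathbf{type}(B)=\mathbf{IT}(A)$; (d) $A$ has a direct summand $B$ of rank $1$ such that $\mathbf{type}(B)=\mathbf{IT}(A)$.
   Context: $R$ is a Dedekind domain with quotient field $\mathbf{Q}$. A torsion-free $R$-module has rank $n$ if it embeds as an essential submodule of $\mathbf{Q}^n$. For a module $A$, a submodule $K$ is $A$-generated if there is an epimorphism $A^{(I)}\to K$ for some set $I$. $A$ is a self-pure-generator if every pure submodule of $A$ is $A$-generated. For $X\subseteq A$, $\langle X\rangle_\star$ denotes the pure submodule of $A$ generated by $X$. Two submodules $A,C$ of a $\mathbf{Q}$-vector space are quasi-equal if $\mathbf{Q}A=\mathbf{Q}C$ and $rC\le A$, $sA\le C$ for some nonzero $r,s\in R$. A quasi-homomorphism $A\to B$ is an element of $\mathbf{Q}\otimes_R\operatorname{Hom}(A,B)$; a quasi-isomorphism is an isomorphism in the category of finite rank torsion-free modules with these morphisms (equivalently, an injective homomorphism $f:A\to B$ with $f(A)$ quasi-equal to $B$, up to rescaling). $B$ is a quasi-direct summand of $A$ if there is a submodule $B'\oplus C\le A$ quasi-equal to $A$ with $B'$ quasi-isomorphic to $B$. The type $\mathbf{type}(B)$ of a rank $1$ torsion-free module $B$ is its quasi-isomorphism class; types are partially ordered by $\mathbf{type}(B)\le\mathbf{type}(C)$ iff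 there is a monomorphism $B\to C$, and form a lattice (for $B,C\le\mathbf{Q}$: $\inf=\mathbf{type}(B\cap C)$). For $0\ne a\in A$, $\mathbf{type}(a)=\mathbf{type}(\langle a\rangle_\star)$. The inner type $\mathbf{IT}(A)=\inf\{\mathbf{type}(x_1),\dots,\mathbf{type}(x_n)\}$ for a maximal independent system $x_1,\dots,x_n$ of $A$; it is independent of the choice and equals the greatest lower bound of the types of all nonzero elements of $A$. *)

theory Defs
  imports "HOL-Library.Function_Algebras"
begin

text \<open>Setting. The quotient field Q of R is a field type 'k, and R is a subset of 'k.
Torsion-free R-modules of finite rank are represented (up to isomorphism) as
R-submodules of Q^n, realised as the function space 'n => 'k for a finite index type 'n,
with pointwise addition and scalar multiplication.\<close>

definition sc :: "'k::field \<Rightarrow> ('n \<Rightarrow> 'k) \<Rightarrow> ('n \<Rightarrow> 'k)" where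
  "sc c v = (\<lambda>i. c * v i)"

definition subring :: "'k::field set \<Rightarrow> bool" where
  "subring R \<longleftrightarrow> 0 \<in> R \<and> 1 \<in> R \<and> (\<forall>x\<in>R. \<forall>y\<in>R. x + y \<in> R \<and> x - y \<in> R \<and> x * y \<in> R)"

definition quotient_field_of :: "'k::field set \<Rightarrow> bool" where
  "quotient_field_of R \<longleftrightarrow> (\<forall>x::'k. \<exists>a\<in>R. \<exists>b\<in>R. b \<noteq> 0 \<and> x = a / b)"

definition ideal_of :: "'k::field set \<Rightarrow> 'k set \<Rightarrow> bool" where
  "ideal_of R I \<longleftrightarrow> I \<subseteq> R \<and> 0 \<in> I \<and> (\<forall>x\<in>I. \<forall>y\<in>I. x + y \<in> I \<and> x - y \<in> I)
     \<and> (\<forall>r\<in>R. \<forall>x\<in>I. r * x \<in> I)"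

definition ideal_mult :: "'k::field set \<Rightarrow> 'k set \<Rightarrow> 'k set" where
  "ideal_mult I J = {(\<Sum>i<n. x i * y i) | (n::nat) x y. \<forall>i<n. x i \<in> I \<and> y i \<in> J}"

definition dedekind_domain :: "'k::field set \<Rightarrow> bool" where
  "dedekind_domain R \<longleftrightarrow> subring R \<and> quotient_field_of R \<and>
     (\<forall>I. ideal_of R I \<and> I \<noteq> {0} \<longrightarrow> (\<exists>J. ideal_mult I J = R))"

definition Rsubmod :: "'k::field set \<Rightarrow> ('n \<Rightarrow> 'k) set \<Rightarrow> bool" where
  "Rsubmod R A \<longleftrightarrow> 0 \<in> A \<and> (\<forall>x\<in>A. \<forall>y\<in>A. x + y \<in> A) \<and> (\<forall>r\<in>R. \<forall>x\<in>A. sc r x \<in> A)"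

definition rhom :: "'k::field set \<Rightarrow> ('n \<Rightarrow> 'k) set \<Rightarrow> ('m \<Rightarrow> 'k) set
     \<Rightarrow> (('n \<Rightarrow> 'k) \<Rightarrow> ('m \<Rightarrow> 'k)) \<Rightarrow> bool" where
  "rhom R A B f \<longleftrightarrow> (\<forall>x\<in>A. f x \<in> B) \<and> (\<forall>x\<in>A. \<forall>y\<in>A. f (x + y) = f x + f y)
     \<and> (\<forall>r\<in>R. \<forall>x\<in>A. f (sc r x) = sc r (f x))"

text \<open>K is A-generated: there is an epimorphism from A^(H) onto K; such a map is the sum of
its component homomorphisms h : A \<rightarrow> K, indexed here by the set H itself.\<close>
definition A_generated :: "'k::field set \<Rightarrow> ('n \<Rightarrow> 'k) set \<Rightarrow> ('n \<Rightarrow> 'k) set \<Rightarrow> bool" where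
  "A_generated R A K \<longleftrightarrow> (\<exists>H. (\<forall>h\<in>H. rhom R A K h) \<and>
     K = {(\<Sum>h\<in>F. h (a h)) | F a. finite F \<and> F \<subseteq> H \<and> (\<forall>h\<in>F. a h \<in> A)})"

definition pure_sub :: "'k::field set \<Rightarrow> ('n \<Rightarrow> 'k) set \<Rightarrow> ('n \<Rightarrow> 'k) set \<Rightarrow> bool" where
  "pure_sub R A S \<longleftrightarrow> Rsubmod R S \<and> S \<subseteq> A \<and> (\<forall>r\<in>R. sc r ` A \<inter> S = sc r ` S)"

definition self_pure_generator :: "'k::field set \<Rightarrow> ('n \<Rightarrow> 'k) set \<Rightarrow> bool" where
  "self_pure_generator R A \<longleftrightarrow> (\<forall>S. pure_sub R A S \<longrightarrow> A_generated R A S)"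

definition pure_hull :: "'k::field set \<Rightarrow> ('n \<Rightarrow> 'k) set \<Rightarrow> ('n \<Rightarrow> 'k) set \<Rightarrow> ('n \<Rightarrow> 'k) set" where
  "pure_hull R A X = \<Inter>{S. pure_sub R A S \<and> X \<subseteq> S}"

definition indep :: "('n \<Rightarrow> 'k::field) list \<Rightarrow> bool" where
  "indep xs \<longleftrightarrow> (\<forall>c. (\<Sum>i<length xs. sc (c i) (xs ! i)) = 0 \<longrightarrow> (\<forall>i<length xs. c i = 0))"

definition has_rank :: "('n \<Rightarrow> 'k::field) set \<Rightarrow> nat \<Rightarrow> bool" where
  "has_rank A k \<longleftrightarrow> (\<exists>xs. set xs \<subseteq> A \<and> length xs = k \<and> indep xs)
     \<and> (\<forall>xs. set xs \<subseteq> A \<and> indep xs \<longrightarrow> length xs \<le> k)"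

definition max_indep_system :: "('n \<Rightarrow> 'k::field) set \<Rightarrow> ('n \<Rightarrow> 'k) list \<Rightarrow> bool" where
  "max_indep_system A xs \<longleftrightarrow> set xs \<subseteq> A \<and> indep xs \<and> (\<forall>x\<in>A. \<not> indep (x # xs))"

definition kspan :: "('n \<Rightarrow> 'k::field) set \<Rightarrow> ('n \<Rightarrow> 'k) set" where
  "kspan X = {(\<Sum>i<n. sc (c i) (x i)) | (n::nat) c x. \<forall>i<n. x i \<in> X}"

text \<open>Types of rank-1 modules: type(B) \<le> type(C) iff there is a monomorphism B \<rightarrow> C.\<close>
definition type_le :: "'k::field set \<Rightarrow> ('n \<Rightarrow> 'k) set \<Rightarrow> ('m \<Rightarrow> 'k) set \<Rightarrow> bool" where
  "type_le R B C \<longleftrightarrow> (\<exists>f. rhom R B C f \<and> inj_on f B)"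

text \<open>type(B) = IT(A): for a maximal independent system x_1..x_n of A, type(B) is the
infimum (greatest lower bound, among all rank-1 modules) of type(<x_i>_*).\<close>
definition type_is_IT :: "'k::field set \<Rightarrow> ('n \<Rightarrow> 'k) set \<Rightarrow> ('m \<Rightarrow> 'k) set \<Rightarrow> bool" where
  "type_is_IT R A B \<longleftrightarrow> (\<exists>xs. max_indep_system A xs \<and>
     (\<forall>x\<in>set xs. type_le R B (pure_hull R A {x})) \<and>
     (\<forall>D::('m \<Rightarrow> 'k) set. Rsubmod R D \<and> has_rank D 1 \<longrightarrow>
        (\<forall>x\<in>set xs. type_le R D (pure_hull R A {x})) \<longrightarrow> type_le R D B))"

definition quasi_equal :: "'k::field set \<Rightarrow> ('n \<Rightarrow> 'k) set \<Rightarrow> ('n \<Rightarrow> 'k) set \<Rightarrow> bool" where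
  "quasi_equal R A C \<longleftrightarrow> kspan A = kspan C \<and>
     (\<exists>r\<in>R. \<exists>s\<in>R. r \<noteq> 0 \<and> s \<noteq> 0 \<and> sc r ` C \<subseteq> A \<and> sc s ` A \<subseteq> C)"

definition quasi_iso :: "'k::field set \<Rightarrow> ('m \<Rightarrow> 'k) set \<Rightarrow> ('n \<Rightarrow> 'k) set \<Rightarrow> bool" where
  "quasi_iso R B B' \<longleftrightarrow> (\<exists>f. rhom R B B' f \<and> inj_on f B \<and> quasi_equal R (f ` B) B')"

definition mod_sum :: "('n \<Rightarrow> 'k::field) set \<Rightarrow> ('n \<Rightarrow> 'k) set \<Rightarrow> ('n \<Rightarrow> 'k) set" where
  "mod_sum B C = {b + c | b c. b \<in> B \<and> c \<in> C}"

end

theory Submission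
  imports Defs "HOL.Vector_Spaces"
begin

text \<open>Call \<open>y\<close> a retract if some \<open>h : A \<rightarrow> \<langle>y\<rangle>\<^sub>\<star>\<close> has
\<open>h y \<noteq> 0\<close>; then \<open>\<langle>y\<rangle>\<^sub>\<star> \<oplus> ker h\<close> is quasi-equal to \<open>A\<close>.
If every pure submodule of rank 1 is \<open>A\<close>-generated, every \<open>x \<noteq> 0\<close> has a nonzero
\<open>h : A \<rightarrow> \<langle>x\<rangle>\<^sub>\<star>\<close>. Passing from \<open>x\<close> to some \<open>x'\<close> with
\<open>h x' \<noteq> 0\<close> does not raise the type, and as long as no retract is met the elements obtained
are linearly independent, so below the type of every \<open>x\<close> there is the type of a retract.
If \<open>h z = 0\<close> and \<open>g y = 0\<close> for retracts \<open>y, z\<close> with maps \<open>h, g\<close>, then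
the type of \<open>y + z\<close> lies below both types; hence the types of retracts are directed
downwards and the inner type is the type of a retract.

Given a functional \<open>\<phi>\<close> on \<open>A\<close> whose image \<open>X\<close> has the inner type, Baer's argument
splits \<open>\<phi>\<close>. It rests on the following fact about submodules of the quotient field: if
\<open>1 \<in> Y\<close>, \<open>X \<noteq> 0\<close> and \<open>s X \<subseteq> Y\<close> for some \<open>s \<noteq> 0\<close>, then
\<open>1 \<in> (Y : X) X\<close>. By the same fact every pure submodule is generated by images of a
rank 1 summand of inner type.\<close>

section \<open>Submodules of the quotient field\<close>

text \<open>Negatives come from \<open>- 1 \<in> R\<close> when \<open>R\<close> is a ring. The
  scalars need not be the Dedekind domain: the definition is applied to \<open>colon X X\<close> as
  well.\<close>

definition Kmod :: "'k::field set \<Rightarrow> 'k set \<Rightarrow> bool" where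
  "Kmod R X \<longleftrightarrow> 0 \<in> X \<and> (\<forall>x\<in>X. \<forall>y\<in>X. x + y \<in> X) \<and> (\<forall>r\<in>R. \<forall>x\<in>X. r * x \<in> X)"

text \<open>The module quotient \<open>(Y : X)\<close> inside the field. For a nonzero ideal
  \<open>I\<close> of a Dedekind domain \<open>R\<close>, \<open>colon R I\<close> is the inverse
  ideal; \<open>colon X X\<close> is the multiplier ring of \<open>X\<close>.\<close>

definition colon :: "'k::field set \<Rightarrow> 'k set \<Rightarrow> 'k set" where
  "colon Y X = {c. \<forall>x\<in>X. c * x \<in> Y}"

lemma colonI: "(\<And>x. x \<in> X \<Longrightarrow> c * x \<in> Y) \<Longrightarrow> c \<in> colon Y X"
  and colonD: "c \<in> colon Y X \<Longrightarrow> x \<in> X \<Longrightarrow> c * x \<in> Y"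
  by (auto simp: colon_def)

lemma Kmod_sum:
  assumes "Kmod R X" "\<And>i. i \<in> F \<Longrightarrow> g i \<in> X"
  shows "sum g F \<in> X"
  using assms by (induction F rule: infinite_finite_induct) (auto simp: Kmod_def)

lemma Kmod_self_colon:
  assumes "Kmod R X"
  shows "Kmod (colon X X) X"
  using assms by (auto simp: Kmod_def colon_def)

lemma Kmod_colon: "Kmod R Y \<Longrightarrow> Kmod R (colon Y X)"
  by (auto simp: Kmod_def colon_def algebra_simps)

lemma ideal_mult_mem: "x \<in> I \<Longrightarrow> y \<in> J \<Longrightarrow> x * y \<in> ideal_mult I J"
  unfolding ideal_mult_def by (intro CollectI exI[of _ 1] exI[of _ "\<lambda>_. x"] exI[of _ "\<lambda>_. y"]) simp

text \<open>Scalars are absorbed by the second factor, so \<open>I\<close> can be an arbitrary set.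
  This makes \<open>(Y : X) X\<close> a module over \<open>colon X X\<close>, which may be larger
  than \<open>R\<close>.\<close>

lemma Kmod_ideal_mult:
  assumes "Kmod E J"
  shows "Kmod E (ideal_mult I J)"
  unfolding Kmod_def
proof (intro conjI ballI)
  show "0 \<in> ideal_mult I J"
    unfolding ideal_mult_def by (intro CollectI exI[of _ 0]) simp
next
  fix a b assume "a \<in> ideal_mult I J" "b \<in> ideal_mult I J"
  then obtain n x y m x' y' where
      *: "a = (\<Sum>i<(n::nat). x i * y i)" "\<forall>i<n. x i \<in> I \<and> y i \<in> J"
        "b = (\<Sum>i<(m::nat). x' i * y' i)" "\<forall>i<m. x' i \<in> I \<and> y' i \<in> J"
    unfolding ideal_mult_def mem_Collect_eq by (elim exE conjE)
  define u where "u i = (if i < n then x i else x' (i - n))" for i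
  define v where "v i = (if i < n then y i else y' (i - n))" for i
  have "(\<Sum>i<n+m. u i * v i) = (\<Sum>i<n. u i * v i) + (\<Sum>i=n..<n+m. u i * v i)"
    by (simp add: lessThan_atLeast0 sum.atLeastLessThan_concat)
  also have "(\<Sum>i<n. u i * v i) = a"
    unfolding *(1) by (intro sum.cong) (auto simp: u_def v_def)
  also have "(\<Sum>i=n..<n+m. u i * v i) = b"
    unfolding *(3) lessThan_atLeast0
    by (rule sum.reindex_bij_witness[of _ "\<lambda>i. i + n" "\<lambda>i. i - n"]) (auto simp: u_def v_def)
  finally have "a + b = (\<Sum>i<n+m. u i * v i)" by simp
  moreover have "\<forall>i<n+m. u i \<in> I \<and> v i \<in> J"
    using *(2,4) by (auto simp: u_def v_def)
  ultimately show "a + b \<in> ideal_mult I J"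
    unfolding ideal_mult_def by blast
next
  fix e a assume e: "e \<in> E" and "a \<in> ideal_mult I J"
  then obtain n x y where *: "a = (\<Sum>i<(n::nat). x i * y i)" "\<forall>i<n. x i \<in> I \<and> y i \<in> J"
    unfolding ideal_mult_def by blast
  have "e * a = (\<Sum>i<n. x i * (e * y i))"
    unfolding * sum_distrib_left by (intro sum.cong) (auto simp: algebra_simps)
  moreover have "\<forall>i<n. x i \<in> I \<and> e * y i \<in> J"
    using * e assms by (auto simp: Kmod_def)
  ultimately show "e * a \<in> ideal_mult I J"
    unfolding ideal_mult_def by (intro CollectI exI[of _ n] exI[of _ x] exI[of _ "\<lambda>i. e * y i"]) simp
qed

section \<open>Linear independence and rank\<close>

interpretation vs: vector_space "sc :: 'k::field \<Rightarrow> ('n \<Rightarrow> 'k) \<Rightarrow> ('n \<Rightarrow> 'k)"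
  by standard (auto simp: sc_def fun_eq_iff algebra_simps)

lemma sum_fun_apply: "(sum f F) i = (\<Sum>j\<in>F. f j i)" for f :: "'a \<Rightarrow> 'b \<Rightarrow> 'c::comm_monoid_add"
  by (induction F rule: infinite_finite_induct) auto

lemma independent_bound:
  fixes S :: "('n::finite \<Rightarrow> 'k::field) set"
  assumes "vs.independent S"
  shows "finite S" "card S \<le> card (UNIV :: 'n set)"
proof -
  define e :: "'n \<Rightarrow> 'n \<Rightarrow> 'k" where "e j = (\<lambda>i. if i = j then 1 else 0)" for j
  have "x \<in> vs.span (range e)" for x :: "'n \<Rightarrow> 'k"
  proof -
    have "x = (\<Sum>j\<in>UNIV. sc (x j) (e j))"
      by (rule ext) (simp add: sum_fun_apply sc_def e_def if_distrib[of "(*) _"] cong: if_cong)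
    moreover have "(\<Sum>j\<in>UNIV. sc (x j) (e j)) \<in> vs.span (range e)"
      by (intro vs.span_sum vs.span_scale vs.span_base) auto
    ultimately show ?thesis by metis
  qed
  then have "finite S \<and> card S \<le> card (range e)"
    using assms by (intro vs.independent_span_bound) auto
  moreover have "card (range e) \<le> card (UNIV :: 'n set)" by (rule card_image_le) simp
  ultimately show "finite S" "card S \<le> card (UNIV :: 'n set)" by auto
qed

lemma indep_iff: "indep xs \<longleftrightarrow> distinct xs \<and> vs.independent (set xs)"
proof (intro iffI conjI)
  assume xs: "indep xs"
  show dist: "distinct xs"
  proof (rule ccontr)
    assume "\<not> distinct xs"
    then obtain i j where ij: "i < length xs" "j < length xs" "i \<noteq> j" "xs ! i = xs ! j"
      by (auto simp: distinct_conv_nth)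
    define c :: "nat \<Rightarrow> 'b" where "c l = (if l = i then 1 else if l = j then -1 else 0)" for l
    have "(\<Sum>l<length xs. sc (c l) (xs ! l)) = (\<Sum>l\<in>{i, j}. sc (c l) (xs ! l))"
      using ij by (intro sum.mono_neutral_right) (auto simp: c_def)
    also have "\<dots> = 0" using ij by (simp add: c_def)
    finally have "c i = 0" using xs ij unfolding indep_def by blast
    then show False by (simp add: c_def)
  qed
  show "vs.independent (set xs)"
  proof
    assume "vs.dependent (set xs)"
    then obtain u where u: "\<exists>v\<in>set xs. u v \<noteq> 0" "(\<Sum>v\<in>set xs. sc (u v) v) = 0"
      by (auto simp: vs.dependent_finite)
    have "(\<Sum>i<length xs. sc (u (xs ! i)) (xs ! i)) = 0"
      using sum.reindex_bij_betw[OF bij_betw_nth[OF dist refl refl], of "\<lambda>v. sc (u v) v"] u by simp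
    then have "\<forall>i<length xs. u (xs ! i) = 0" using xs[unfolded indep_def, rule_format, of "\<lambda>i. u (xs ! i)"] by blast
    then show False using u by (metis in_set_conv_nth)
  qed
next
  assume *: "distinct xs \<and> vs.independent (set xs)"
  then have bij: "bij_betw (nth xs) {..<length xs} (set xs)" by (intro bij_betw_nth) auto
  show "indep xs"
    unfolding indep_def
  proof (intro allI impI)
    fix c :: "nat \<Rightarrow> 'b" and i
    assume c: "(\<Sum>i<length xs. sc (c i) (xs ! i)) = 0" and i: "i < length xs"
    define u where "u v = c (inv_into {..<length xs} (nth xs) v)" for v
    have u: "u (xs ! i) = c i" if "i < length xs" for i
      using bij that by (auto simp: u_def bij_betw_def inv_into_f_f)
    have "(\<Sum>v\<in>set xs. sc (u v) v) = (\<Sum>i<length xs. sc (u (xs ! i)) (xs ! i))"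
      using sum.reindex_bij_betw[OF bij, of "\<lambda>v. sc (u v) v"] by simp
    also have "\<dots> = 0" unfolding c[symmetric] by (intro sum.cong) (auto simp: u)
    finally have "\<forall>v\<in>set xs. u v = 0"
      using * vs.dependent_finite[OF finite_set] by blast
    then show "c i = 0" using u[OF i] i by (metis nth_mem)
  qed
qed

lemma max_indep_system_span:
  assumes "max_indep_system A xs"
  shows "A \<subseteq> vs.span (set xs)"
proof
  fix a assume "a \<in> A"
  then have "\<not> indep (a # xs)" and "indep xs" using assms by (auto simp: max_indep_system_def)
  then show "a \<in> vs.span (set xs)"
    by (auto simp: indep_iff vs.independent_insert intro: vs.span_base split: if_splits)
qed

lemma max_indep_system_exists:
  fixes A :: "('n::finite \<Rightarrow> 'k::field) set"
  obtains xs where "max_indep_system A xs"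
proof -
  obtain B where B: "B \<subseteq> A" "vs.independent B" "A \<subseteq> vs.span B"
    by (rule vs.maximal_independent_subset)
  obtain xs where xs: "set xs = B" "distinct xs"
    using independent_bound[OF B(2)] finite_distinct_list by blast
  show ?thesis
    using B xs by (intro that[of xs]) (auto simp: max_indep_system_def indep_iff vs.independent_insert)
qed

lemma has_rank_1E:
  assumes "has_rank B 1"
  obtains b where "b \<in> B" "b \<noteq> 0" "\<And>x. x \<in> B \<Longrightarrow> \<exists>t. x = sc t b"
proof -
  obtain xs where xs: "set xs \<subseteq> B" "length xs = 1" "indep xs"
    and le: "\<And>ys. set ys \<subseteq> B \<Longrightarrow> indep ys \<Longrightarrow> length ys \<le> 1"
    using assms unfolding has_rank_def by blast
  obtain b where b: "xs = [b]" using xs(2) by (cases xs) auto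
  show ?thesis
  proof (rule that[of b])
    show "b \<in> B" "b \<noteq> 0" using xs b by (auto simp: indep_iff)
    fix x assume "x \<in> B"
    then have "\<not> indep [x, b]" using le[of "[x, b]"] xs b by auto
    then have "x \<in> vs.span {b}"
      using xs(3) b by (auto simp: indep_iff vs.independent_insert intro: vs.span_base split: if_splits)
    then show "\<exists>t. x = sc t b" by (auto simp: vs.span_singleton)
  qed
qed

lemma has_rank_1I:
  assumes "b \<in> B" "b \<noteq> 0" "\<And>x. x \<in> B \<Longrightarrow> \<exists>t. x = sc t b"
  shows "has_rank B 1"
  unfolding has_rank_def
proof (intro conjI exI[of _ "[b]"] allI impI)
  fix xs assume xs: "set xs \<subseteq> B \<and> indep xs"
  have "B \<subseteq> vs.span {b}" using assms(3) by (auto simp: vs.span_singleton)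
  then have "card (set xs) \<le> card {b}"
    using xs by (intro conjunct2[OF vs.independent_span_bound]) (auto simp: indep_iff)
  then show "length xs \<le> 1" using xs by (simp add: indep_iff distinct_card)
qed (use assms in \<open>auto simp: indep_iff\<close>)

text \<open>The relation says that the type of \<open>x\<close> is at most the type of \<open>y\<close>: a homomorphism
between the pure submodules generated by \<open>x\<close> and \<open>y\<close> is multiplication by some \<open>k\<close>.\<close>
definition type_below :: "('n \<Rightarrow> 'k::field) set \<Rightarrow> ('n \<Rightarrow> 'k) \<Rightarrow> ('n \<Rightarrow> 'k) \<Rightarrow> bool" where
  "type_below A x y \<longleftrightarrow> (\<exists>k. k \<noteq> 0 \<and> (\<forall>t. sc t x \<in> A \<longrightarrow> sc (k * t) y \<in> A))"

lemma type_below_refl: "type_below A x x"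
  unfolding type_below_def by (intro exI[of _ 1]) auto

lemma type_below_trans:
  assumes "type_below A x y" "type_below A y z"
  shows "type_below A x z"
proof -
  obtain k l where kl: "k \<noteq> 0" "\<forall>t. sc t x \<in> A \<longrightarrow> sc (k * t) y \<in> A"
    "l \<noteq> 0" "\<forall>t. sc t y \<in> A \<longrightarrow> sc (l * t) z \<in> A"
    using assms unfolding type_below_def by blast
  then have "\<forall>t. sc t x \<in> A \<longrightarrow> sc (l * k * t) z \<in> A"
    unfolding mult.assoc by blast
  then show ?thesis
    unfolding type_below_def using kl(1,3) by (intro exI[of _ "l * k"] conjI) simp_all
qed

definition retract :: "'k::field set \<Rightarrow> ('n \<Rightarrow> 'k) set \<Rightarrow> ('n \<Rightarrow> 'k) \<Rightarrow> bool" where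
  "retract R A y \<longleftrightarrow> y \<in> A \<and> (\<exists>h. rhom R A (pure_hull R A {y}) h \<and> h y \<noteq> 0)"

section \<open>Ideals of a Dedekind domain\<close>

context
  fixes R :: "'k::field set"
  assumes ded: "dedekind_domain R"
begin

lemma subring_R: "0 \<in> R" "1 \<in> R" "x \<in> R \<Longrightarrow> y \<in> R \<Longrightarrow> x + y \<in> R"
  "x \<in> R \<Longrightarrow> y \<in> R \<Longrightarrow> x - y \<in> R" "x \<in> R \<Longrightarrow> y \<in> R \<Longrightarrow> x * y \<in> R"
  using ded by (auto simp: dedekind_domain_def subring_def)

lemma Kmod_R: "Kmod R R"
  by (simp add: Kmod_def subring_R)

lemma fraction:
  obtains a b where "a \<in> R" "b \<in> R" "b \<noteq> 0" "(x::'k) = a / b"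
  using ded unfolding dedekind_domain_def quotient_field_of_def by blast

lemma clear_denominator:
  obtains d where "d \<in> R" "d \<noteq> 0" "d * (z::'k) \<in> R"
proof -
  obtain a b where "a \<in> R" "b \<in> R" "b \<noteq> 0" "z = a / b" by (rule fraction)
  then show ?thesis by (intro that[of b]) auto
qed

lemma Kmod_diff:
  assumes "Kmod R X" "x \<in> X" "y \<in> X" shows "x - y \<in> X"
proof -
  have "- 1 \<in> R" using subring_R(4)[OF subring_R(1,2)] by simp
  then have "- 1 * y \<in> X" using assms unfolding Kmod_def by blast
  then have "x + - 1 * y \<in> X" using assms unfolding Kmod_def by blast
  then show ?thesis by simp
qed

lemma ideal_of_iff: "ideal_of R I \<longleftrightarrow> Kmod R I \<and> I \<subseteq> R"
  using Kmod_diff by (auto simp: ideal_of_def Kmod_def)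

text \<open>Since \<open>I\<close> is invertible, \<open>z\<close> is a sum of products \<open>a b z\<close> with \<open>a \<in> I\<close> and
\<open>b \<in> I\<^sup>-\<^sup>1\<close>.\<close>
lemma inverse_ideal_induct:
  assumes I: "Kmod R I" "I \<subseteq> R" "I \<noteq> {0}"
    and M: "Kmod R M" "\<And>a b. a \<in> I \<Longrightarrow> b \<in> colon R I \<Longrightarrow> a * b * z \<in> M"
  shows "z \<in> M"
proof -
  obtain J where J: "ideal_mult I J = R"
    using ded I ideal_of_iff unfolding dedekind_domain_def by blast
  then obtain n x y where *: "1 = (\<Sum>i<(n::nat). x i * y i)" "\<forall>i<n. x i \<in> I \<and> y i \<in> J"
    using subring_R(2) unfolding ideal_mult_def by blast
  have "y i \<in> colon R I" if "i < n" for i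
    using ideal_mult_mem[of _ I "y i" J] J * that by (intro colonI) (auto simp: mult.commute)
  then have "(\<Sum>i<n. x i * y i * z) \<in> M"
    using * by (intro Kmod_sum[OF M(1)] M(2)) auto
  also have "(\<Sum>i<n. x i * y i * z) = z"
    unfolding sum_distrib_right[symmetric] by (simp flip: *(1))
  finally show ?thesis .
qed

text \<open>With \<open>z = a / b\<close> the ideal \<open>(a, b)\<close> is invertible, so
  \<open>1\<close> is a sum of products \<open>x y\<close> with \<open>x = u a + v b\<close> and
  \<open>y\<close> in the inverse ideal. Since \<open>a = b z\<close>, each product is
  \<open>v (y b) + u (y b) z\<close>, which has the required shape. The result replaces the
  alternative, valid in a valuation ring, that \<open>z\<close> or \<open>1 / z\<close> lies in the
  ring.\<close>

lemma two_generated_invertible: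
  obtains g g' where "g \<in> R" "g' \<in> R" "g * z \<in> R" "g' * z \<in> R" "1 = g + g' * (z::'k)"
proof -
  obtain a b where ab: "a \<in> R" "b \<in> R" "b \<noteq> 0" "z = a / b" by (rule fraction)
  define I where "I = {u * a + v * b | u v. u \<in> R \<and> v \<in> R}"
  define M where "M = {g + g' * z | g g'. g \<in> R \<and> g' \<in> R \<and> g * z \<in> R \<and> g' * z \<in> R}"
  have I: "Kmod R I" "I \<subseteq> R"
    unfolding Kmod_def
  proof (intro conjI ballI)
    show "0 \<in> I" unfolding I_def using subring_R(1) by force
    show "x + y \<in> I" if xy: "x \<in> I" "y \<in> I" for x y
    proof -
      obtain u v u' v' where *: "x = u * a + v * b" "y = u' * a + v' * b" "u \<in> R" "v \<in> R" "u' \<in> R" "v' \<in> R"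
        using xy unfolding I_def by blast
      have "x + y = (u + u') * a + (v + v') * b" by (simp add: * algebra_simps)
      then show ?thesis unfolding I_def using * subring_R by blast
    qed
    show "r * x \<in> I" if rx: "r \<in> R" "x \<in> I" for r x
    proof -
      obtain u v where *: "x = u * a + v * b" "u \<in> R" "v \<in> R"
        using rx unfolding I_def by blast
      have "r * x = (r * u) * a + (r * v) * b" by (simp add: * algebra_simps)
      then show ?thesis unfolding I_def using * that subring_R by blast
    qed
    show "I \<subseteq> R" unfolding I_def using ab subring_R(3,5) by auto
  qed
  have aI: "a \<in> I" and bI: "b \<in> I"
    unfolding I_def using subring_R(1,2) by force+
  have M: "Kmod R M"
    unfolding Kmod_def
  proof (intro conjI ballI)
    show "0 \<in> M" unfolding M_def using subring_R(1) by force
    show "x + y \<in> M" if xy: "x \<in> M" "y \<in> M" for x y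
    proof -
      obtain u v u' v' where *: "x = u + v * z" "y = u' + v' * z" "u \<in> R" "v \<in> R" "u' \<in> R" "v' \<in> R"
         "u * z \<in> R" "v * z \<in> R" "u' * z \<in> R" "v' * z \<in> R"
        using xy unfolding M_def by blast
      have "x + y = (u + u') + (v + v') * z" by (simp add: * algebra_simps)
      moreover have "(u + u') * z \<in> R" "(v + v') * z \<in> R"
        unfolding distrib_right using * subring_R by auto
      ultimately show ?thesis unfolding M_def using * subring_R(3) by blast
    qed
    show "r * x \<in> M" if rx: "r \<in> R" "x \<in> M" for r x
    proof -
      obtain u v where *: "x = u + v * z" "u \<in> R" "v \<in> R" "u * z \<in> R" "v * z \<in> R"
        using rx unfolding M_def by blast
      have "r * x = (r * u) + (r * v) * z" by (simp add: * algebra_simps)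
      moreover have "r * u * z \<in> R" "r * v * z \<in> R"
        unfolding mult.assoc using * that subring_R by auto
      ultimately show ?thesis unfolding M_def using * that subring_R(5) by blast
    qed
  qed
  have "1 \<in> M"
  proof (rule inverse_ideal_induct[OF I _ M])
    show "I \<noteq> {0}" using bI ab by auto
    fix x y assume x: "x \<in> I" and y: "y \<in> colon R I"
    obtain u v where *: "x = u * a + v * b" "u \<in> R" "v \<in> R"
      using x unfolding I_def by blast
    have "y * a \<in> R" "y * b \<in> R" using y aI bI by (auto dest: colonD)
    then have "u * (y * a) \<in> R" "u * (y * b) \<in> R" "v * (y * a) \<in> R" "v * (y * b) \<in> R"
      using * subring_R by auto
    moreover have "x * y * 1 = v * (y * b) + u * (y * b) * z"
      using ab by (simp add: * field_simps)
    moreover have "v * (y * b) * z = v * (y * a)" "u * (y * b) * z = u * (y * a)"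
      using ab by (simp_all add: field_simps)
    ultimately show "x * y * 1 \<in> M"
      unfolding M_def
      by (intro CollectI exI[of _ "v * (y * b)"] exI[of _ "u * (y * b)"] conjI) (simp_all only:)
  qed
  then show ?thesis using that unfolding M_def by blast
qed

text \<open>Zorn's lemma among the ideals \<open>P \<supseteq> J\<close> with
  \<open>colon R P\<close> not inside \<open>E\<close>. The union of a chain is invertible, hence
  finitely generated, and therefore equals a member of the chain. For \<open>E = colon X X\<close>
  the condition on a nonzero \<open>P\<close> says that \<open>P X \<noteq> X\<close>.\<close>

lemma maximal_ideal_exists:
  assumes J: "Kmod R J" "J \<subseteq> R" "J \<noteq> {0}" "\<not> colon R J \<subseteq> E"
  obtains P where "Kmod R P" "P \<subseteq> R" "J \<subseteq> P" "\<not> colon R P \<subseteq> E"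
    "\<And>Q. Kmod R Q \<Longrightarrow> Q \<subseteq> R \<Longrightarrow> P \<subset> Q \<Longrightarrow> colon R Q \<subseteq> E"
proof -
  define F where "F = {P. Kmod R P \<and> P \<subseteq> R \<and> J \<subseteq> P \<and> \<not> colon R P \<subseteq> E}"
  have "\<exists>M\<in>F. \<forall>X\<in>F. M \<subseteq> X \<longrightarrow> X = M"
  proof (rule subset_Zorn_nonempty)
    show "F \<noteq> {}" using J unfolding F_def by blast
    fix \<C> assume ne: "\<C> \<noteq> {}" and "subset.chain F \<C>"
    then have CF: "\<C> \<subseteq> F" and ch: "\<And>X Y. X \<in> \<C> \<Longrightarrow> Y \<in> \<C> \<Longrightarrow> X \<subseteq> Y \<or> Y \<subseteq> X"
      by (auto simp: subset_chain_def)
    have C: "Kmod R P" "P \<subseteq> R" "J \<subseteq> P" "\<not> colon R P \<subseteq> E" if "P \<in> \<C>" for P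
      using CF that by (auto simp: F_def)
    have U: "Kmod R (\<Union>\<C>)"
      unfolding Kmod_def
    proof (intro conjI ballI)
      show "0 \<in> \<Union>\<C>" using ne C(1) by (auto simp: Kmod_def)
      show "x + y \<in> \<Union>\<C>" if xy: "x \<in> \<Union>\<C>" "y \<in> \<Union>\<C>" for x y
      proof -
        obtain P Q where "x \<in> P" "y \<in> Q" "P \<in> \<C>" "Q \<in> \<C>" using xy by blast
        with ch[of P Q] obtain S where "x \<in> S" "y \<in> S" "S \<in> \<C>" by blast
        then show ?thesis using C(1)[of S] by (auto simp: Kmod_def)
      qed
      show "r * x \<in> \<Union>\<C>" if "r \<in> R" "x \<in> \<Union>\<C>" for r x
        using that C(1) unfolding Kmod_def by blast
    qed
    obtain P0 where P0: "P0 \<in> \<C>" using ne by blast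
    have "\<exists>P\<in>\<C>. 1 \<in> ideal_mult P (colon R (\<Union>\<C>))"
    proof -
      let ?M = "\<Union>P\<in>\<C>. ideal_mult P (colon R (\<Union>\<C>))"
      have mono: "ideal_mult P K \<subseteq> ideal_mult Q K" if "P \<subseteq> Q" for P Q K :: "'k set"
        unfolding ideal_mult_def using that by blast
      have K: "Kmod R (ideal_mult P (colon R (\<Union>\<C>)))" for P
        by (intro Kmod_ideal_mult Kmod_colon Kmod_R)
      have "1 \<in> ?M"
      proof (rule inverse_ideal_induct[OF U])
        show "\<Union>\<C> \<subseteq> R" using C(2) by blast
        show "\<Union>\<C> \<noteq> {0}" using P0 C(3)[OF P0] J(1,3) unfolding Kmod_def by blast
        show "a * b * 1 \<in> ?M" if "a \<in> \<Union>\<C>" "b \<in> colon R (\<Union>\<C>)" for a b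
          using that ideal_mult_mem[of a _ b "colon R (\<Union>\<C>)"] by auto
        show "Kmod R ?M"
          unfolding Kmod_def
        proof (intro conjI ballI)
          show "0 \<in> ?M" using P0 K[of P0] unfolding Kmod_def by blast
          show "r * x \<in> ?M" if "r \<in> R" "x \<in> ?M" for r x
            using that K unfolding Kmod_def by (meson UN_iff)
          show "x + y \<in> ?M" if xy: "x \<in> ?M" "y \<in> ?M" for x y
          proof -
            obtain P Q where "x \<in> ideal_mult P (colon R (\<Union>\<C>))" "y \<in> ideal_mult Q (colon R (\<Union>\<C>))"
              "P \<in> \<C>" "Q \<in> \<C>" using xy by blast
            with ch[of P Q] mono obtain S where
              "x \<in> ideal_mult S (colon R (\<Union>\<C>))" "y \<in> ideal_mult S (colon R (\<Union>\<C>))" "S \<in> \<C>"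
              by blast
            then show ?thesis using K[of S] by (auto simp: Kmod_def)
          qed
        qed
      qed
      then show ?thesis by blast
    qed
    then obtain P n x y where P: "P \<in> \<C>" "1 = (\<Sum>i<(n::nat). x i * y i)"
      "\<forall>i<n. x i \<in> P \<and> y i \<in> colon R (\<Union>\<C>)"
      unfolding ideal_mult_def by blast
    \<comment> \<open>Each \<open>z\<close> in the union is the sum of the
      \<open>(y i * z) * x i\<close>, where \<open>y i * z \<in> R\<close> and
      \<open>x i \<in> P\<close>.\<close>
    have "\<Union>\<C> \<subseteq> P"
    proof
      fix z assume z: "z \<in> \<Union>\<C>"
      have "(\<Sum>i<n. (y i * z) * x i) \<in> P"
        using P z C(1)[OF P(1)] by (intro Kmod_sum[OF C(1)[OF P(1)]]) (auto simp: Kmod_def dest!: colonD)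
      also have "(\<Sum>i<n. (y i * z) * x i) = (\<Sum>i<n. x i * y i) * z"
        unfolding sum_distrib_right by (intro sum.cong) (auto simp: algebra_simps)
      finally show "z \<in> P" by (simp flip: P(2))
    qed
    then have "\<Union>\<C> = P" using P(1) by blast
    then show "\<Union>\<C> \<in> F" using P(1) CF by blast
  qed
  then show ?thesis using that unfolding F_def by (smt (verit) mem_Collect_eq psubset_eq subset_trans)
qed

text \<open>The ideal \<open>P Q\<^sup>-\<^sup>1\<close> is strictly larger than \<open>P\<close> unless \<open>Q = R\<close>, and \<open>P\<^sup>-\<^sup>1\<close> is
generated by the products of elements of \<open>(P Q\<^sup>-\<^sup>1)\<^sup>-\<^sup>1\<close> and \<open>Q\<^sup>-\<^sup>1\<close>.\<close>
lemma maximal_ideal_comaximal: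
  assumes P: "Kmod R P" "P \<subseteq> R" "P \<noteq> {0}" "\<not> colon R P \<subseteq> E"
    and E: "Kmod R E" "\<And>x y. x \<in> E \<Longrightarrow> y \<in> E \<Longrightarrow> x * y \<in> E"
    and max: "\<And>Q. Kmod R Q \<Longrightarrow> Q \<subseteq> R \<Longrightarrow> P \<subset> Q \<Longrightarrow> colon R Q \<subseteq> E"
    and Q: "Kmod R Q" "Q \<subseteq> R" "P \<subset> Q"
  shows "1 \<in> Q"
proof -
  define P' where "P' = R \<inter> colon P Q"
  have Kint: "Kmod R (A \<inter> B)" if "Kmod R A" "Kmod R B" for A B
    using that by (auto simp: Kmod_def)
  have P': "Kmod R P'" "P' \<subseteq> R"
    unfolding P'_def using P by (auto intro: Kint Kmod_R Kmod_colon)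
  have "P \<subseteq> colon P Q"
  proof (intro subsetI colonI)
    fix b q assume "b \<in> P" "q \<in> Q"
    then have "q * b \<in> P" using P(1) Q(2) unfolding Kmod_def by blast
    then show "b * q \<in> P" by (simp add: mult.commute)
  qed
  then have PP': "P \<subseteq> P'" unfolding P'_def using P by blast
  have Q0: "Q \<noteq> {0}" using Q(3) P(1) unfolding Kmod_def by blast
  have Qinv: "colon R Q \<subseteq> E" using max Q by blast
  have "\<not> P \<subset> P'"
  proof
    assume "P \<subset> P'"
    then have P'inv: "colon R P' \<subseteq> E" using max P' by blast
    have "colon R P \<subseteq> E"
    proof
      fix c assume c: "c \<in> colon R P"
      show "c \<in> E"
      proof (rule inverse_ideal_induct[OF Q(1,2) Q0 E(1)])
        fix a b assume a: "a \<in> Q" and b: "b \<in> colon R Q"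
        have "c * a \<in> colon R P'"
        proof (rule colonI)
          fix x assume "x \<in> P'"
          then have "x * a \<in> P" using a by (auto simp: P'_def dest: colonD)
          then have "c * (x * a) \<in> R" by (rule colonD[OF c])
          then show "c * a * x \<in> R" by (simp add: algebra_simps)
        qed
        then have "(c * a) * b \<in> E" using P'inv Qinv b by (blast intro: E(2))
        then show "a * b * c \<in> E" by (simp add: algebra_simps)
      qed
    qed
    then show False using P by blast
  qed
  then have P'_eq: "P' = P" using PP' by blast
  \<comment> \<open>Multiplication by \<open>colon R Q\<close> takes \<open>P\<close> into
    \<open>P' = P\<close>; cancelling the invertible ideal \<open>P\<close> leaves
    \<open>colon R Q \<subseteq> R\<close>, which forces \<open>Q = R\<close>.\<close>
  have QR: "colon R Q \<subseteq> R"
  proof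
    fix q assume q: "q \<in> colon R Q"
    show "q \<in> R"
    proof (rule inverse_ideal_induct[OF P(1-3) Kmod_R])
      fix a b assume a: "a \<in> P" and b: "b \<in> colon R P"
      have "q * a \<in> P'"
        unfolding P'_def
      proof (intro IntI colonI)
        show "q * a \<in> R" using a Q q by (auto intro: colonD)
        fix x assume "x \<in> Q"
        then have "(q * x) * a \<in> P" using a P colonD[OF q] by (auto simp: Kmod_def)
        then show "q * a * x \<in> P" by (simp add: algebra_simps)
      qed
      then have "b * (q * a) \<in> R" using P'_eq colonD[OF b] by simp
      then show "a * b * q \<in> R" by (simp add: algebra_simps)
    qed
  qed
  show "1 \<in> Q"
  proof (rule inverse_ideal_induct[OF Q(1,2) Q0 Q(1)])
    fix a b assume "a \<in> Q" "b \<in> colon R Q"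
    then have "b * a \<in> Q" using Q(1) QR unfolding Kmod_def by blast
    then show "a * b * 1 \<in> Q" by (simp add: mult.commute)
  qed
qed

text \<open>Otherwise \<open>(Y : X) X\<close> meets \<open>R\<close> in an ideal below a maximal ideal \<open>P\<close> with
\<open>P X \<noteq> X\<close>. As \<open>X\<close> is cyclic locally at \<open>P\<close>, with generator \<open>x\<close>, the ideal
\<open>I = {t. (t / x) X \<subseteq> Y} \<subseteq> P\<close> satisfies \<open>P\<^sup>-\<^sup>1 I \<subseteq> I\<close>, which is impossible for
an invertible ideal.\<close>
lemma one_mem_colon_mult:
  assumes X: "Kmod R X" "x0 \<in> X" "x0 \<noteq> 0"
    and Y: "Kmod R Y" "1 \<in> Y"
    and s: "s \<noteq> 0" "s \<in> colon Y X"
  shows "1 \<in> ideal_mult (colon Y X) X"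
proof (rule ccontr)
  assume contra: "1 \<notin> ideal_mult (colon Y X) X"
  define E where "E = colon X X"
  define M where "M = ideal_mult (colon Y X) X"
  define J where "J = R \<inter> M"
  have E: "Kmod R E" "\<And>x y. x \<in> E \<Longrightarrow> y \<in> E \<Longrightarrow> x * y \<in> E" "R \<subseteq> E"
    unfolding E_def using X(1) Kmod_colon[OF X(1)] by (auto simp: colon_def Kmod_def mult.assoc)
  have ME: "Kmod E M" unfolding M_def E_def by (intro Kmod_ideal_mult Kmod_self_colon[OF X(1)])
  then have M: "Kmod R M" using E(3) unfolding Kmod_def by blast
  have J: "Kmod R J" "J \<subseteq> R" unfolding J_def using M Kmod_R by (auto simp: Kmod_def)
  have J0: "J \<noteq> {0}"
  proof -
    have "s * x0 \<in> M" unfolding M_def using s X by (intro ideal_mult_mem)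
    moreover obtain r where r: "r \<in> R" "r \<noteq> 0" "r * (s * x0) \<in> R" by (rule clear_denominator)
    ultimately have "r * (s * x0) \<in> J" using M by (auto simp: J_def Kmod_def)
    then show ?thesis using r s X by force
  qed
  \<comment> \<open>Otherwise \<open>1\<close>, a sum of products of elements of
    \<open>J \<subseteq> M\<close> and of \<open>colon R J \<subseteq> E\<close>, would lie in the
    \<open>E\<close>-module \<open>M\<close>.\<close>
  have "\<not> colon R J \<subseteq> E"
  proof
    assume JE: "colon R J \<subseteq> E"
    have "1 \<in> M"
    proof (rule inverse_ideal_induct[OF J J0 M])
      fix a b assume "a \<in> J" "b \<in> colon R J"
      then have "b * a \<in> M" using JE ME by (auto simp: J_def Kmod_def)
      then show "a * b * 1 \<in> M" by (simp add: mult.commute)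
    qed
    then show False using contra M_def by simp
  qed
  then obtain P where P: "Kmod R P" "P \<subseteq> R" "J \<subseteq> P" "\<not> colon R P \<subseteq> E"
    and Pmax: "\<And>Q. Kmod R Q \<Longrightarrow> Q \<subseteq> R \<Longrightarrow> P \<subset> Q \<Longrightarrow> colon R Q \<subseteq> E"
    using maximal_ideal_exists[OF J J0] by blast
  have P0: "P \<noteq> {0}" using P J0 J by (auto simp: Kmod_def)
  obtain c x where c: "c \<in> colon R P" and x: "x \<in> X" and cx: "c * x \<notin> X"
    using P(4) unfolding E_def colon_def[of X X] by blast
  have x_ne: "x \<noteq> 0" using cx X by (auto simp: Kmod_def)
  text \<open>Locally at \<open>P\<close> the module \<open>X\<close> is generated by \<open>x\<close>.\<close>
  have local_gen: "\<exists>h\<in>R - P. h * x' / x \<in> R" if x': "x' \<in> X" for x'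
  proof -
    \<comment> \<open>If both coefficients lay in \<open>P\<close>, multiplying
      \<open>x = g x + g' x'\<close> by \<open>c\<close> would give \<open>c x \<in> X\<close>. The
      one outside \<open>P\<close> serves as \<open>h\<close>.\<close>
    obtain g g' where g: "g \<in> R" "g' \<in> R" "g * (x' / x) \<in> R" "g' * (x' / x) \<in> R" "1 = g + g' * (x' / x)"
      by (rule two_generated_invertible)
    have "\<not> (g \<in> P \<and> g' \<in> P)"
    proof
      assume "g \<in> P \<and> g' \<in> P"
      then have "c * g \<in> R" "c * g' \<in> R" using c by (auto dest: colonD)
      then have "(c * g) * x + (c * g') * x' \<in> X" using X x x' by (auto simp: Kmod_def)
      also have "(c * g) * x + (c * g') * x' = c * x * (g + g' * (x' / x))"
        using x_ne by (simp add: field_simps)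
      finally show False using cx g(5) by simp
    qed
    then show ?thesis using g by auto
  qed
  define I where "I = {t \<in> R. t / x \<in> colon Y X}"
  have I: "Kmod R I" "I \<subseteq> R"
    unfolding I_def using Kmod_colon[OF Y(1), of X] Kmod_R
    by (auto simp: Kmod_def add_divide_distrib)
       (metis times_divide_eq_right)
  have IJ: "I \<subseteq> J"
  proof
    fix t assume t: "t \<in> I"
    then have "(t / x) * x \<in> M" unfolding M_def I_def using x by (intro ideal_mult_mem) auto
    then show "t \<in> J" using t x_ne by (auto simp: J_def I_def)
  qed
  have I0: "I \<noteq> {0}"
  proof -
    obtain r where r: "r \<in> R" "r \<noteq> 0" "r * (s * x) \<in> R" by (rule clear_denominator)
    have "r * (s * x) / x \<in> colon Y X"
      using x_ne r s Kmod_colon[OF Y(1), of X] by (auto simp: Kmod_def)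
    then have "r * (s * x) \<in> I" using r by (auto simp: I_def)
    then show ?thesis using r s x_ne by force
  qed
  have stable: "w * i \<in> I" if w: "w \<in> colon R P" and i: "i \<in> I" for w i
  proof -
    have wi: "w * i \<in> R" using w i IJ P(3) by (auto dest: colonD)
    have "w * i / x * x' \<in> Y" if x': "x' \<in> X" for x'
    proof -
      obtain h where h: "h \<in> R" "h \<notin> P" "h * x' / x \<in> R" using local_gen[OF x'] by blast
      \<comment> \<open>The ideal \<open>P + R h\<close> properly contains \<open>P\<close>, hence
        is \<open>R\<close>. In \<open>1 = b + r h\<close>, multiplication by
        \<open>b \<in> P\<close> brings \<open>w\<close> into \<open>R\<close>, and multiplication
        by \<open>h\<close> clears the denominator of \<open>x' / x\<close>.\<close>
      define Q where "Q = {b + r * h | b r. b \<in> P \<and> r \<in> R}"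
      have Q: "Kmod R Q"
        unfolding Kmod_def
      proof (intro conjI ballI)
        show "0 \<in> Q" unfolding Q_def using P(1) subring_R(1) by (force simp: Kmod_def)
        show "y + z \<in> Q" if yz: "y \<in> Q" "z \<in> Q" for y z
        proof -
          obtain b r b' r' where *: "y = b + r * h" "z = b' + r' * h" "b \<in> P" "b' \<in> P" "r \<in> R" "r' \<in> R"
            using yz unfolding Q_def by blast
          have "y + z = (b + b') + (r + r') * h" by (simp add: * algebra_simps)
          moreover have "b + b' \<in> P" using * P(1) by (auto simp: Kmod_def)
          ultimately show ?thesis unfolding Q_def using * subring_R(3) by blast
        qed
        show "u * y \<in> Q" if uy: "u \<in> R" "y \<in> Q" for u y
        proof -
          obtain b r where *: "y = b + r * h" "b \<in> P" "r \<in> R"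
            using uy unfolding Q_def by blast
          have "u * y = u * b + (u * r) * h" by (simp add: * algebra_simps)
          moreover have "u * b \<in> P" using * uy P(1) by (auto simp: Kmod_def)
          ultimately show ?thesis unfolding Q_def using * uy subring_R(5) by blast
        qed
      qed
      have "P \<subseteq> Q" unfolding Q_def using subring_R(1) by force
      moreover have "h \<in> Q" unfolding Q_def using subring_R(2) P(1) by (force simp: Kmod_def)
      ultimately have "P \<subset> Q" using h by blast
      moreover have "Q \<subseteq> R" unfolding Q_def using P(2) h subring_R(3,5) by auto
      ultimately have "1 \<in> Q" using maximal_ideal_comaximal[OF P(1,2) P0 P(4) E(1,2) Pmax Q] by blast
      then obtain b r where br: "1 = b + r * h" "b \<in> P" "r \<in> R" unfolding Q_def by blast
      have "w * b \<in> R" using w br by (auto dest: colonD)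
      moreover have "i / x * x' \<in> Y" using i x' by (auto simp: I_def dest: colonD)
      ultimately have "(w * b) * (i / x * x') \<in> Y" using Y unfolding Kmod_def by blast
      \<comment> \<open>The scalar lies in \<open>R\<close>, so this membership rests on
        \<open>1 \<in> Y\<close>.\<close>
      moreover have "(w * i) * r * (h * x' / x) * 1 \<in> Y"
        using Y wi br h subring_R(5) unfolding Kmod_def by blast
      ultimately have "(w * b) * (i / x * x') + (w * i) * r * (h * x' / x) * 1 \<in> Y"
        using Y unfolding Kmod_def by blast
      also have "(w * b) * (i / x * x') + (w * i) * r * (h * x' / x) * 1 = (w * i / x * x') * (b + r * h)"
        by (simp add: algebra_simps add_divide_distrib)
      finally show ?thesis using br by simp
    qed
    then show ?thesis using wi by (auto simp: I_def intro: colonI)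
  qed
  \<comment> \<open>Multiplication by \<open>colon R P\<close> preserves \<open>I\<close>, and the
    invertible ideal \<open>I\<close> can be cancelled. As \<open>R \<subseteq> E\<close>, this
    contradicts the choice of \<open>P\<close>.\<close>
  have "colon R P \<subseteq> R"
  proof
    fix w assume w: "w \<in> colon R P"
    show "w \<in> R"
    proof (rule inverse_ideal_induct[OF I I0 Kmod_R])
      fix a b assume "a \<in> I" and b: "b \<in> colon R I"
      then have "b * (w * a) \<in> R" using stable[OF w] by (auto dest: colonD)
      then show "a * b * w \<in> R" by (simp add: algebra_simps)
    qed
  qed
  then show False using P(4) E(3) by blast
qed

section \<open>Pure submodules of rank one and types\<close>

lemma Rsubmod_closed:
  assumes "Rsubmod R A"
  shows "0 \<in> A" "x \<in> A \<Longrightarrow> y \<in> A \<Longrightarrow> x + y \<in> A" "r \<in> R \<Longrightarrow> x \<in> A \<Longrightarrow> sc r x \<in> A"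
    "x \<in> A \<Longrightarrow> y \<in> A \<Longrightarrow> x - y \<in> A"
proof -
  have add: "\<And>x y. x \<in> A \<Longrightarrow> y \<in> A \<Longrightarrow> x + y \<in> A"
    and sc: "\<And>r x. r \<in> R \<Longrightarrow> x \<in> A \<Longrightarrow> sc r x \<in> A"
    using assms by (auto simp: Rsubmod_def)
  have "- 1 \<in> R" using subring_R by (metis diff_0)
  then have "y \<in> A \<Longrightarrow> - y \<in> A" using sc[of "-1" y] by simp
  then show "x \<in> A \<Longrightarrow> y \<in> A \<Longrightarrow> x - y \<in> A" using add[of x "- y"] by simp
  show "0 \<in> A" using assms by (simp add: Rsubmod_def)
qed (use assms in \<open>auto simp: Rsubmod_def\<close>)

lemma Kmod_coordinates:
  assumes "Rsubmod R A"
  shows "Kmod R {t. sc t x \<in> A}"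
  using Rsubmod_closed[OF assms] by (auto simp: Kmod_def vs.scale_left_distrib simp flip: vs.scale_scale)

lemma rhom_zero:
  assumes "rhom R A B h" "Rsubmod R A"
  shows "h 0 = 0"
proof -
  have "h (0 + 0) = h 0 + h 0"
    using assms(1) Rsubmod_closed(1)[OF assms(2)] unfolding rhom_def by blast
  then show ?thesis by simp
qed

text \<open>Both sides agree after multiplication by a denominator of \<open>t\<close>, and the
  codomain is torsion-free.\<close>

lemma rhom_scale:
  assumes "rhom R A B h" "a \<in> A" "sc t a \<in> A"
  shows "h (sc t a) = sc t (h a)"
proof -
  obtain m d where md: "m \<in> R" "d \<in> R" "d \<noteq> 0" "t = m / d" by (rule fraction)
  have "sc d (h (sc t a)) = h (sc d (sc t a))" using assms(1,3) md(2) unfolding rhom_def by metis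
  also have "sc d (sc t a) = sc m a" using md by simp
  also have "h (sc m a) = sc m (h a)" using assms md by (auto simp: rhom_def)
  also have "sc m (h a) = sc d (sc t (h a))" using md by simp
  finally show ?thesis using vs.scale_left_imp_eq[OF md(3)] by blast
qed

text \<open>Multiplying by a denominator \<open>d\<close> of \<open>t\<close> lands in
  \<open>d A \<inter> S = d S\<close>, where \<open>d\<close> can be cancelled.\<close>

lemma pure_sub_scale:
  assumes "pure_sub R A S" "x \<in> S" "sc t x \<in> A"
  shows "sc t x \<in> S"
proof -
  obtain m d where md: "m \<in> R" "d \<in> R" "d \<noteq> 0" "t = m / d" by (rule fraction)
  have "sc d (sc t x) = sc m x" using md by simp
  moreover have "sc m x \<in> S" using assms md by (auto simp: pure_sub_def Rsubmod_def)
  ultimately have "sc d (sc t x) \<in> sc d ` A \<inter> S" using assms(3) by (metis IntI imageI)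
  then have "sc d (sc t x) \<in> sc d ` S" using assms(1) md(2) unfolding pure_sub_def by blast
  then show ?thesis using vs.scale_left_imp_eq[OF md(3)] by blast
qed

lemma pure_hull_singleton:
  assumes A: "Rsubmod R A" and x: "x \<in> A"
  shows "pure_hull R A {x} = {v \<in> A. \<exists>t. v = sc t x}" (is "_ = ?S")
    and "pure_sub R A (pure_hull R A {x})"
proof -
  note A = Rsubmod_closed[OF A]
  have pure: "pure_sub R A ?S"
    unfolding pure_sub_def
  proof (intro conjI ballI)
    show "Rsubmod R ?S"
      unfolding Rsubmod_def using A
      by (auto intro: exI[of _ 0] exI[of _ "_ * _"])
         (metis vs.scale_left_distrib)
    fix r assume r: "r \<in> R"
    show "sc r ` A \<inter> ?S = sc r ` ?S"
    proof (cases "r = 0")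
      case True
      then show ?thesis using A x by (auto intro: exI[of _ 0])
    next
      case False
      show ?thesis
      proof (intro equalityI subsetI)
        fix v assume "v \<in> sc r ` A \<inter> ?S"
        then obtain a t where at: "a \<in> A" "v = sc r a" "v = sc t x" by blast
        have "a = sc (1 / r) v" using at(2) False by simp
        also have "\<dots> = sc (1 / r * t) x" using at(3) by simp
        finally show "v \<in> sc r ` ?S" using at by blast
      qed (use A r in auto)
    qed
  qed auto
  have "x \<in> ?S" using x by (auto intro: exI[of _ 1])
  then show eq: "pure_hull R A {x} = ?S"
    unfolding pure_hull_def using pure pure_sub_scale by fastforce
  show "pure_sub R A (pure_hull R A {x})" unfolding eq by (rule pure)
qed

lemma pure_hull_facts:
  assumes A: "Rsubmod R A" and x: "x \<in> A"
  shows "x \<in> pure_hull R A {x}" "pure_hull R A {x} \<subseteq> A" "Rsubmod R (pure_hull R A {x})"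
    "x \<noteq> 0 \<Longrightarrow> has_rank (pure_hull R A {x}) 1"
proof -
  note eq = pure_hull_singleton(1)[OF assms]
  show "x \<in> pure_hull R A {x}" using eq x by (auto intro: exI[of _ 1])
  then show "x \<noteq> 0 \<Longrightarrow> has_rank (pure_hull R A {x}) 1" by (rule has_rank_1I) (auto simp: eq)
  show "pure_hull R A {x} \<subseteq> A" "Rsubmod R (pure_hull R A {x})"
    using pure_hull_singleton(2)[OF assms] by (auto simp: pure_sub_def)
qed

lemma rhom_pure_hull_below:
  assumes A: "Rsubmod R A" and y: "y \<in> A" and h: "rhom R A (pure_hull R A {y}) h"
    and x: "x \<in> A" "h x \<noteq> 0"
  shows "type_below A x y"
proof -
  note hull = pure_hull_singleton(1)[OF A y]
  obtain q where q: "h x = sc q y" using h x unfolding rhom_def hull by blast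
  have "sc (q * t) y \<in> A" if "sc t x \<in> A" for t
  proof -
    have "h (sc t x) = sc (q * t) y"
      using rhom_scale[OF h x(1) that] q by (simp add: mult.commute)
    moreover have "h (sc t x) \<in> A" using h that unfolding rhom_def hull by blast
    ultimately show ?thesis by simp
  qed
  moreover have "q \<noteq> 0" using q x by auto
  ultimately show ?thesis unfolding type_below_def by blast
qed

section \<open>Uniform multipliers, splitting functionals and the comparison of types\<close>

lemma span_multiplier:
  assumes A: "Rsubmod R A"
    and S: "\<And>x. x \<in> S \<Longrightarrow> \<exists>k. k \<noteq> 0 \<and> (\<forall>t\<in>X. sc (k * t) x \<in> A)"
    and v: "v \<in> vs.span S"
  shows "\<exists>k\<in>R. k \<noteq> 0 \<and> (\<forall>t\<in>X. sc (k * t) v \<in> A)"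
proof -
  note A = Rsubmod_closed[OF A] and R = subring_R
  \<comment> \<open>The vectors with a common multiplier for all of \<open>X\<close> form a
    subspace: for a sum the two multipliers are multiplied, and a scalar \<open>m / d\<close> costs
    a factor \<open>d\<close>. Hence bounds on a maximal independent system extend to all of
    \<open>A\<close>.\<close>
  define U where "U = {v. \<exists>k\<in>R. k \<noteq> 0 \<and> (\<forall>t\<in>X. sc (k * t) v \<in> A)}"
  have "vs.subspace U"
  proof (rule vs.subspaceI)
    show "0 \<in> U" unfolding U_def using R A by (auto intro: bexI[of _ 1])
  next
    fix x y assume "x \<in> U" "y \<in> U"
    then obtain k l where kl: "k \<in> R" "k \<noteq> 0" "\<forall>t\<in>X. sc (k * t) x \<in> A"
      "l \<in> R" "l \<noteq> 0" "\<forall>t\<in>X. sc (l * t) y \<in> A"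
      unfolding U_def by blast
    have "sc (k * l * t) (x + y) \<in> A" if t: "t \<in> X" for t
    proof -
      have "sc l (sc (k * t) x) + sc k (sc (l * t) y) \<in> A" using kl t by (intro A(2) A(3)[where r = k] A(3)[where r = l]) auto
      then show ?thesis by (simp add: vs.scale_right_distrib ac_simps)
    qed
    then show "x + y \<in> U" unfolding U_def using kl R(5) by (intro CollectI bexI[of _ "k * l"]) auto
  next
    fix c x assume "x \<in> U"
    then obtain k where k: "k \<in> R" "k \<noteq> 0" "\<forall>t\<in>X. sc (k * t) x \<in> A"
      unfolding U_def by blast
    obtain m d where md: "m \<in> R" "d \<in> R" "d \<noteq> 0" "c = m / d" by (rule fraction)
    have "sc (d * k * t) (sc c x) \<in> A" if t: "t \<in> X" for t
    proof -
      have "sc m (sc (k * t) x) \<in> A" using md k t by (intro A(3)[where r = m]) auto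
      then show ?thesis using md by (simp add: ac_simps)
    qed
    then show "sc c x \<in> U" unfolding U_def using k md R(5) by (intro CollectI bexI[of _ "d * k"]) auto
  qed
  moreover have "S \<subseteq> U"
  proof
    fix x assume "x \<in> S"
    then obtain k where k: "k \<noteq> 0" "\<forall>t\<in>X. sc (k * t) x \<in> A" using S by blast
    obtain d where d: "d \<in> R" "d \<noteq> 0" "d * k \<in> R" by (rule clear_denominator)
    have "sc (d * k * t) x \<in> A" if t: "t \<in> X" for t
    proof -
      have "sc d (sc (k * t) x) \<in> A" using d k t by (intro A(3)[where r = d]) auto
      then show ?thesis by (simp add: algebra_simps)
    qed
    then show "x \<in> U" unfolding U_def using k d by (intro CollectI bexI[of _ "d * k"]) auto
  qed
  ultimately have "vs.span S \<subseteq> U" by (intro vs.span_minimal)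
  then show ?thesis using v unfolding U_def by blast
qed

text \<open>If \<open>b\<close> were in the rational span of \<open>C\<close>, a nonzero multiple of
  it would lie in \<open>B \<inter> C\<close>. So \<open>b\<close> is independent of a basis of that
  span, and there is a functional with value \<open>1\<close> at \<open>b\<close> and
  \<open>0\<close> on the basis.\<close>

lemma splitting_functional:
  fixes B :: "('m \<Rightarrow> 'k) set"
  assumes B: "Rsubmod R B" and C: "Rsubmod R C" and BC: "B \<inter> C = {0}"
    and b: "b \<in> B" "b \<noteq> 0"
  obtains \<phi> where "\<And>u v. \<phi> (u + v) = \<phi> u + \<phi> v" "\<And>t v. \<phi> (sc t v) = t * \<phi> v"
    "\<phi> b = 1" "\<And>c. c \<in> C \<Longrightarrow> \<phi> c = 0"
proof -
  interpret functional: vector_space_pair "sc :: 'k \<Rightarrow> ('m \<Rightarrow> 'k) \<Rightarrow> ('m \<Rightarrow> 'k)" "(*)"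
    by standard (auto simp: algebra_simps)
  obtain D where D: "D \<subseteq> C" "vs.independent D" "C \<subseteq> vs.span D"
    by (rule vs.maximal_independent_subset)
  have "b \<notin> vs.span D"
  proof
    assume bD: "b \<in> vs.span D"
    have *: "\<exists>k. k \<noteq> 0 \<and> (\<forall>t\<in>{1}. sc (k * t) x \<in> C)" if "x \<in> D" for x
      using that D by (intro exI[of _ 1]) auto
    obtain k where k: "k \<in> R" "k \<noteq> 0" "sc k b \<in> C"
      using span_multiplier[of C D "{1}", OF C * bD] by auto
    then have "sc k b \<in> B \<inter> C" using Rsubmod_closed(3)[OF B] b by blast
    then show False using BC k b by auto
  qed
  then have "vs.independent (insert b D)" "b \<notin> D"
    using D vs.span_base by (auto simp: vs.independent_insert)
  then obtain \<phi> where \<phi>: "Vector_Spaces.linear sc (*) \<phi>" "\<forall>x\<in>insert b D. \<phi> x = (if x = b then 1 else 0)"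
    using functional.linear_independent_extend[of "insert b D" "\<lambda>x. if x = b then 1 else 0"] by blast
  show ?thesis
  proof (rule that[of \<phi>])
    show "\<phi> (u + v) = \<phi> u + \<phi> v" "\<phi> (sc t v) = t * \<phi> v" for u v t
      using \<phi>(1) unfolding Vector_Spaces.linear_iff by auto
    show "\<phi> b = 1" using \<phi> by simp
    fix c assume "c \<in> C"
    moreover have "\<phi> x = 0" if "x \<in> D" for x using \<phi>(2) that \<open>b \<notin> D\<close> by auto
    ultimately show "\<phi> c = 0" using D functional.linear_eq_0_on_span[OF \<phi>(1), of D c] by auto
  qed
qed

lemma type_le_hullD:
  assumes A: "Rsubmod R A" and x: "x \<in> A" and B: "Rsubmod R B" "b \<in> B" "b \<noteq> 0"
    and le: "type_le R B (pure_hull R A {x})"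
  shows "\<exists>k. k \<noteq> 0 \<and> (\<forall>t\<in>{t. sc t b \<in> B}. sc (k * t) x \<in> A)"
proof -
  note hull = pure_hull_singleton(1)[OF A x]
  obtain f where f: "rhom R B (pure_hull R A {x}) f" "inj_on f B"
    using le unfolding type_le_def by blast
  obtain k where k: "f b = sc k x" using f(1) B unfolding rhom_def hull by blast
  have "f b \<noteq> f 0" using f(2) B Rsubmod_closed(1)[OF B(1)] by (auto dest: inj_onD)
  then have "k \<noteq> 0" using k rhom_zero[OF f(1) B(1)] by auto
  moreover have "sc (k * t) x \<in> A" if t: "sc t b \<in> B" for t
  proof -
    have "f (sc t b) = sc (k * t) x"
      using rhom_scale[OF f(1) B(2) t] k by (simp add: mult.commute)
    moreover have "f (sc t b) \<in> A" using f t unfolding rhom_def hull by blast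
    ultimately show ?thesis by simp
  qed
  ultimately show ?thesis by blast
qed

lemma type_le_hullI:
  fixes B :: "('m \<Rightarrow> 'k) set"
  assumes A: "Rsubmod R A" and y: "y \<in> A" "y \<noteq> 0"
    and B: "Rsubmod R B" "b \<in> B" "b \<noteq> 0" "\<And>x. x \<in> B \<Longrightarrow> \<exists>t. x = sc t b"
    and k: "k \<noteq> 0" "\<And>t. sc t b \<in> B \<Longrightarrow> sc (k * t) y \<in> A"
  shows "type_le R B (pure_hull R A {y})"
proof -
  note hull = pure_hull_singleton(1)[OF A y(1)]
  \<comment> \<open>Splitting with complement \<open>0\<close> produces a coordinate function on
    \<open>B\<close> with respect to \<open>b\<close>.\<close>
  have zero: "Rsubmod R ({0} :: ('m \<Rightarrow> 'k) set)" "B \<inter> {0} = {0}" using B Rsubmod_closed(1)[OF B(1)] by (auto simp: Rsubmod_def)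
  obtain \<phi> :: "('m \<Rightarrow> 'k) \<Rightarrow> 'k" where \<phi>: "\<And>u v. \<phi> (u + v) = \<phi> u + \<phi> v" "\<And>t v. \<phi> (sc t v) = t * \<phi> v" "\<phi> b = 1"
    using splitting_functional[OF B(1) zero B(2,3)] by metis
  have B_eq: "x = sc (\<phi> x) b" if "x \<in> B" for x using B(4)[OF that] \<phi> by auto
  define f where "f v = sc (k * \<phi> v) y" for v
  have "f v \<in> pure_hull R A {y}" if "v \<in> B" for v
    using k(2)[of "\<phi> v"] B_eq[OF that] that unfolding hull f_def by auto
  then have "rhom R B (pure_hull R A {y}) f"
    by (simp add: rhom_def f_def \<phi> algebra_simps vs.scale_left_distrib)
  moreover have "inj_on f B"
  proof (rule inj_onI)
    fix u v assume uv: "u \<in> B" "v \<in> B" "f u = f v"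
    then have "\<phi> u = \<phi> v" using k y by (simp add: f_def)
    then show "u = v" using B_eq uv by metis
  qed
  ultimately show ?thesis unfolding type_le_def by blast
qed

lemma type_is_IT_below:
  assumes A: "Rsubmod R A" and B: "Rsubmod R B" "b \<in> B" "b \<noteq> 0"
    and IT: "type_is_IT R A B" and a: "a \<in> A"
  shows "\<exists>k\<in>R. k \<noteq> 0 \<and> (\<forall>t\<in>{t. sc t b \<in> B}. sc (k * t) a \<in> A)"
proof -
  obtain xs where xs: "max_indep_system A xs" "\<forall>x\<in>set xs. type_le R B (pure_hull R A {x})"
    using IT unfolding type_is_IT_def by blast
  show ?thesis
  proof (rule span_multiplier[OF A])
    show "a \<in> vs.span (set xs)" using max_indep_system_span[OF xs(1)] a by blast
    show "\<exists>k. k \<noteq> 0 \<and> (\<forall>t\<in>{t. sc t b \<in> B}. sc (k * t) x \<in> A)" if "x \<in> set xs" for x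
      using xs that by (intro type_le_hullD[OF A _ B]) (auto simp: max_indep_system_def)
  qed
qed

text \<open>The hull is greatest among the lower bounds because \<open>v\<close> itself is in the
  span of \<open>xs\<close>: a rank 1 module whose type is below that of each entry is then below
  that of \<open>v\<close>.\<close>

lemma type_is_IT_hullI:
  fixes A :: "('n::finite \<Rightarrow> 'k) set"
  assumes A: "Rsubmod R A" and v: "v \<in> A" "v \<noteq> 0"
    and xs: "max_indep_system A xs" "\<And>x. x \<in> set xs \<Longrightarrow> type_below A v x"
  shows "type_is_IT R A (pure_hull R A {v})"
  unfolding type_is_IT_def
proof (intro exI[of _ xs] conjI ballI allI impI)
  fix x assume x: "x \<in> set xs"
  then have xA: "x \<in> A" and x0: "x \<noteq> 0"
    using xs(1) vs.dependent_zero[of "set xs"] by (auto simp: max_indep_system_def indep_iff)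
  obtain k where "k \<noteq> 0" "\<forall>t. sc t v \<in> A \<longrightarrow> sc (k * t) x \<in> A"
    using xs(2)[OF x] unfolding type_below_def by blast
  then show "type_le R (pure_hull R A {v}) (pure_hull R A {x})"
    using pure_hull_facts(1-3)[OF A v(1)] v(2)
    by (intro type_le_hullI[OF A xA x0, where b = v and k = k])
       (auto simp: pure_hull_singleton(1)[OF A v(1)])
next
  fix D :: "('n \<Rightarrow> 'k) set"
  assume D: "Rsubmod R D \<and> has_rank D 1" and le: "\<forall>x\<in>set xs. type_le R D (pure_hull R A {x})"
  obtain d where d: "d \<in> D" "d \<noteq> 0" "\<And>x. x \<in> D \<Longrightarrow> \<exists>t. x = sc t d"
    using D has_rank_1E by blast
  have *: "\<exists>k. k \<noteq> 0 \<and> (\<forall>t\<in>{t. sc t d \<in> D}. sc (k * t) x \<in> A)" if "x \<in> set xs" for x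
    using xs(1) D d le that by (intro type_le_hullD[OF A]) (auto simp: max_indep_system_def)
  have "v \<in> vs.span (set xs)" using max_indep_system_span[OF xs(1)] v by blast
  then obtain k where "k \<noteq> 0" "\<forall>t\<in>{t. sc t d \<in> D}. sc (k * t) v \<in> A"
    using span_multiplier[OF A *] by blast
  then show "type_le R D (pure_hull R A {v})"
    using D d by (intro type_le_hullI[OF A v]) auto
qed (rule xs(1))


section \<open>Splitting off a direct summand of inner type\<close>

text \<open>An \<open>E\<close>-submodule \<open>J\<close> of \<open>E = X : X\<close> is generated over \<open>E\<close> by its intersection with
\<open>R\<close>.\<close>
lemma colon_submodule_factor:
  assumes X: "Kmod R X" and J: "Kmod (colon X X) J" "J \<subseteq> colon X X" and m: "m \<in> J"
    and w: "w \<in> colon R (R \<inter> J)"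
  shows "w * m \<in> colon X X"
proof -
  let ?E = "colon X X"
  have E: "Kmod R ?E" "R \<subseteq> ?E" "\<And>x y. x \<in> ?E \<Longrightarrow> y \<in> ?E \<Longrightarrow> x * y \<in> ?E"
    using X Kmod_colon[OF X] by (auto simp: colon_def Kmod_def mult.assoc)
  obtain g g' where g: "g \<in> R" "g' \<in> R" "g * m \<in> R" "g' * m \<in> R" "1 = g + g' * m"
    by (rule two_generated_invertible)
  have "g * m \<in> J" "g' * m \<in> J" using g E(2) J(1) m unfolding Kmod_def by blast+
  then have "w * (g * m) \<in> R" "w * (g' * m) \<in> R" using w g by (auto dest: colonD)
  moreover have "m \<in> ?E" using J m by blast
  ultimately have "w * (g * m) + w * (g' * m) * m \<in> ?E"
    using E unfolding Kmod_def by blast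
  also have "w * (g * m) + w * (g' * m) * m = w * m * (g + g' * m)" by (simp add: algebra_simps)
  finally show ?thesis using g(5) by simp
qed

text \<open>A vector \<open>v\<close> with \<open>X v \<subseteq> A\<close>, where
  \<open>X = \<phi>(A)\<close>, gives a map from \<open>X\<close> to \<open>A\<close> sending
  \<open>t\<close> to \<open>t v\<close>; it splits \<open>\<phi>\<close> exactly when
  \<open>\<phi> v = 1\<close>. The values \<open>\<phi> v\<close> of such vectors form an ideal
  \<open>J'\<close> of the multiplier ring of \<open>X\<close>, and invertibility of
  \<open>J = R \<inter> J'\<close> yields \<open>1 \<in> J'\<close>.\<close>

lemma baer_splitting:
  assumes A: "Rsubmod R A"
    and \<phi>: "\<And>u v. \<phi> (u + v) = \<phi> u + \<phi> v" "\<And>t v. \<phi> (sc t v) = t * \<phi> v"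
    and b: "b \<in> A" "\<phi> b \<noteq> 0"
    and below: "\<And>a. a \<in> A \<Longrightarrow> \<exists>k. k \<noteq> 0 \<and> (\<forall>t\<in>\<phi> ` A. sc (k * t) a \<in> A)"
  obtains v where "\<phi> v = (1::'k)" "\<And>t. t \<in> \<phi> ` A \<Longrightarrow> sc t v \<in> A"
proof -
  define X where "X = \<phi> ` A"
  define E where "E = colon X X"
  define J' where "J' = \<phi> ` {v. \<forall>t\<in>X. sc t v \<in> A}"
  note Ac = Rsubmod_closed[OF A]
  have \<phi>0: "\<phi> 0 = 0" using \<phi>(2)[of 0 0] by simp
  have XK: "Kmod R X"
    unfolding Kmod_def X_def
  proof (intro conjI ballI)
    show "0 \<in> \<phi> ` A" using Ac(1) \<phi>0 by force
  qed (use Ac \<phi> in \<open>auto simp flip: \<phi>\<close>)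
  have J'E: "J' \<subseteq> E"
    unfolding J'_def E_def
  proof (intro image_subsetI colonI)
    fix v t assume v: "v \<in> {v. \<forall>t\<in>X. sc t v \<in> A}" and "t \<in> X"
    then have "\<phi> (sc t v) \<in> X" unfolding X_def by blast
    then show "\<phi> v * t \<in> X" by (simp add: \<phi> mult.commute)
  qed
  have J'K: "Kmod E J'"
    unfolding Kmod_def
  proof (intro conjI ballI)
    show "0 \<in> J'" unfolding J'_def using Ac(1) \<phi>0 by (intro image_eqI[of _ _ 0]) auto
  next
    fix x y assume "x \<in> J'" "y \<in> J'"
    then obtain u v where *: "x = \<phi> u" "\<forall>t\<in>X. sc t u \<in> A" "y = \<phi> v" "\<forall>t\<in>X. sc t v \<in> A"
      unfolding J'_def by blast
    then show "x + y \<in> J'"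
      unfolding J'_def using Ac(2) by (intro image_eqI[of _ _ "u + v"]) (auto simp: \<phi> vs.scale_right_distrib)
  next
    fix e x assume e: "e \<in> E" and "x \<in> J'"
    then obtain u where u: "x = \<phi> u" "\<forall>t\<in>X. sc t u \<in> A" unfolding J'_def by blast
    have "sc t (sc e u) \<in> A" if "t \<in> X" for t
      using u(2) colonD[OF e[unfolded E_def] that] by (simp add: mult.commute)
    then show "e * x \<in> J'"
      unfolding J'_def u(1) by (intro image_eqI[of _ _ "sc e u"]) (auto simp: \<phi>)
  qed
  have EK: "Kmod R E" "R \<subseteq> E"
    unfolding E_def using XK Kmod_colon[OF XK] by (auto simp: colon_def Kmod_def mult.assoc)
  then have J'R: "Kmod R J'" using J'K unfolding Kmod_def by blast
  define J where "J = R \<inter> J'"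
  have J: "Kmod R J" "J \<subseteq> R" unfolding J_def using J'R Kmod_R by (auto simp: Kmod_def)
  have J0: "J \<noteq> {0}"
  proof -
    obtain k where k: "k \<noteq> 0" "\<forall>t\<in>X. sc (k * t) b \<in> A" using below[OF b(1)] unfolding X_def by blast
    obtain d where d: "d \<in> R" "d \<noteq> 0" "d * (k * \<phi> b) \<in> R" by (rule clear_denominator)
    have "k * \<phi> b \<in> J'"
      unfolding J'_def using k by (intro image_eqI[of _ _ "sc k b"]) (auto simp: \<phi> mult.commute)
    then have "d * (k * \<phi> b) \<in> J" unfolding J_def using d J'R unfolding Kmod_def by blast
    then show ?thesis using d k b by force
  qed
  \<comment> \<open>For \<open>y = \<phi> a\<close> write \<open>1\<close> as a sum of products
    \<open>c i * x i\<close>. Multiplying \<open>c i a\<close> by any element of \<open>X\<close>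
    stays in \<open>A\<close>, so \<open>c i * y \<in> J'\<close>; hence
    \<open>w * (c i * y)\<close> maps \<open>X\<close> to itself and can be applied to
    \<open>x i\<close>.\<close>
  have "colon R J \<subseteq> E"
    unfolding E_def
  proof (intro subsetI colonI)
    fix w y assume w: "w \<in> colon R J" and "y \<in> X"
    then obtain a where a: "a \<in> A" "y = \<phi> a" unfolding X_def by blast
    define Y where "Y = {t. sc t a \<in> A}"
    obtain k where k: "k \<noteq> 0" "\<forall>t\<in>X. sc (k * t) a \<in> A" using below[OF a(1)] unfolding X_def by blast
    have "1 \<in> ideal_mult (colon Y X) X"
    proof (rule one_mem_colon_mult[OF XK])
      show "\<phi> b \<in> X" unfolding X_def using b by blast
      show "Kmod R Y" unfolding Y_def by (rule Kmod_coordinates[OF A])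
      show "1 \<in> Y" unfolding Y_def using a by simp
      show "k \<in> colon Y X" unfolding Y_def using k by (auto intro: colonI)
    qed (use k b in auto)
    then obtain n c x where cx: "1 = (\<Sum>i<(n::nat). c i * x i)" "\<forall>i<n. c i \<in> colon Y X \<and> x i \<in> X"
      unfolding ideal_mult_def by blast
    have "w * (c i * y) * x i \<in> X" if i: "i < n" for i
    proof -
      have "sc t (sc (c i) a) \<in> A" if "t \<in> X" for t
        using cx(2) i colonD[of "c i" Y X t] that by (auto simp: Y_def mult.commute)
      then have "c i * y \<in> J'"
        unfolding J'_def a by (intro image_eqI[of _ _ "sc (c i) a"]) (auto simp: \<phi>)
      then have "w * (c i * y) \<in> colon X X"
        using colon_submodule_factor[OF XK, of J'] J'K J'E w unfolding E_def J_def by blast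
      then show ?thesis using cx(2) i by (auto dest: colonD)
    qed
    then have "(\<Sum>i<n. w * (c i * y) * x i) \<in> X" by (intro Kmod_sum[OF XK]) auto
    also have "(\<Sum>i<n. w * (c i * y) * x i) = w * y * (\<Sum>i<n. c i * x i)"
      unfolding sum_distrib_left by (intro sum.cong) (auto simp: algebra_simps)
    finally show "w * y \<in> X" by (simp flip: cx(1))
  qed
  have "1 \<in> J'"
  proof (rule inverse_ideal_induct[OF J J0 J'R])
    fix x y assume "x \<in> J" "y \<in> colon R J"
    then have "y * x \<in> J'" using J'K \<open>colon R J \<subseteq> E\<close> unfolding J_def Kmod_def by blast
    then show "x * y * 1 \<in> J'" by (simp add: mult.commute)
  qed
  then show ?thesis using that unfolding J'_def X_def by (metis (no_types, lifting) image_iff mem_Collect_eq)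
qed

section \<open>From a rank 1 summand of inner type to generation of all pure submodules\<close>

lemma A_generatedI:
  assumes A: "Rsubmod R A" and S: "Rsubmod R S"
    and gen: "\<And>s. s \<in> S \<Longrightarrow>
      \<exists>n h a. (\<forall>i<(n::nat). rhom R A S (h i) \<and> a i \<in> A) \<and> s = (\<Sum>i<n. h i (a i))"
  shows "A_generated R A S"
proof -
  define H where "H = {h. rhom R A S h}"
  define G where "G = {(\<Sum>h\<in>F. h (a h)) | F a. finite F \<and> F \<subseteq> H \<and> (\<forall>h\<in>F. a h \<in> A)}"
  note Ac = Rsubmod_closed[OF A] and Sc = Rsubmod_closed[OF S]
  have H0: "h 0 = 0" if "h \<in> H" for h using that rhom_zero[OF _ A] by (auto simp: H_def)
  have G0: "0 \<in> G" unfolding G_def by (intro CollectI exI[of _ "{}"]) simp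
  have Gh: "h a \<in> G" if "h \<in> H" "a \<in> A" for h a
    unfolding G_def using that by (intro CollectI exI[of _ "{h}"] exI[of _ "\<lambda>_. a"]) simp
  have Gadd: "x + y \<in> G" if x: "x \<in> G" and y: "y \<in> G" for x y
  proof -
    obtain F a where F: "x = (\<Sum>h\<in>F. h (a h))" "finite F" "F \<subseteq> H" "\<forall>h\<in>F. a h \<in> A"
      using x unfolding G_def by blast
    obtain F' a' where F': "y = (\<Sum>h\<in>F'. h (a' h))" "finite F'" "F' \<subseteq> H" "\<forall>h\<in>F'. a' h \<in> A"
      using y unfolding G_def by blast
    \<comment> \<open>The argument \<open>0\<close> outside the respective support lets both sums
      run over \<open>F \<union> F'\<close>; it contributes nothing because homomorphisms vanish at
      \<open>0\<close>.\<close>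
    define p where "p h = (if h \<in> F then a h else 0)" for h
    define q where "q h = (if h \<in> F' then a' h else 0)" for h
    have pq: "p h \<in> A" "q h \<in> A" for h using F F' Ac(1) by (auto simp: p_def q_def)
    have "(\<Sum>h\<in>F \<union> F'. h (p h)) = (\<Sum>h\<in>F. h (p h))"
    proof (rule sum.mono_neutral_right)
      show "\<forall>h\<in>F \<union> F' - F. h (p h) = 0"
        using F'(3) H0 by (auto simp only: p_def if_False)
    qed (use F F' in auto)
    also have "\<dots> = x" unfolding F(1) by (intro sum.cong) (auto simp: p_def)
    finally have x: "(\<Sum>h\<in>F \<union> F'. h (p h)) = x" .
    have "(\<Sum>h\<in>F \<union> F'. h (q h)) = (\<Sum>h\<in>F'. h (q h))"
    proof (rule sum.mono_neutral_right)
      show "\<forall>h\<in>F \<union> F' - F'. h (q h) = 0"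
        using F(3) H0 by (auto simp only: q_def if_False)
    qed (use F F' in auto)
    also have "\<dots> = y" unfolding F'(1) by (intro sum.cong) (auto simp: q_def)
    finally have y: "(\<Sum>h\<in>F \<union> F'. h (q h)) = y" .
    have "x + y = (\<Sum>h\<in>F \<union> F'. h (p h) + h (q h))" by (simp add: sum.distrib x y)
    also have "\<dots> = (\<Sum>h\<in>F \<union> F'. h (p h + q h))"
    proof (rule sum.cong)
      fix h assume "h \<in> F \<union> F'"
      then have "rhom R A S h" using F F' by (auto simp: H_def)
      then show "h (p h) + h (q h) = h (p h + q h)" using pq by (auto simp: rhom_def)
    qed simp
    finally show ?thesis
      unfolding G_def using F F' pq Ac(2)
      by (intro CollectI exI[of _ "F \<union> F'"] exI[of _ "\<lambda>h. p h + q h"]) auto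
  qed
  have "G = S"
  proof (intro equalityI subsetI)
    fix x assume "x \<in> G"
    then obtain F a where F: "x = (\<Sum>h\<in>F. h (a h))" "finite F" "F \<subseteq> H" "\<forall>h\<in>F. a h \<in> A"
      unfolding G_def by blast
    from F(2-4) show "x \<in> S"
      unfolding F(1) using Sc(1,2) by (induction F rule: finite_induct) (auto simp: H_def rhom_def)
  next
    fix s assume "s \<in> S"
    then obtain n h a where *: "\<forall>i<(n::nat). rhom R A S (h i) \<and> a i \<in> A" "s = (\<Sum>i<n. h i (a i))"
      using gen by blast
    from *(1) show "s \<in> G"
      unfolding *(2) using G0 Gadd Gh by (induction n) (auto simp: H_def)
  qed
  then show ?thesis unfolding A_generated_def G_def H_def by (intro exI[of _ "{h. rhom R A S h}"]) auto
qed

text \<open>The coordinate \<open>\<phi>\<close> along \<open>B\<close> maps \<open>A\<close> into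
  \<open>X\<close>. For \<open>s \<in> S\<close>, inner type provides some
  \<open>k \<noteq> 0\<close> with \<open>k X s \<subseteq> A\<close>, so \<open>1\<close> is a sum
  of products \<open>c i * x i\<close> with \<open>x i \<in> X\<close> and
  \<open>c i X s \<subseteq> A\<close>. The maps sending \<open>v\<close> to
  \<open>c i \<phi>(v) s\<close> have values in \<open>S\<close> by purity, and their values at the
  \<open>x i b\<close> add up to \<open>s\<close>.\<close>

lemma summand_imp_self_pure_generator:
  assumes A: "Rsubmod R A" and B: "Rsubmod R B" "B \<subseteq> A" "has_rank B 1" and C: "Rsubmod R C"
    and BC: "B \<inter> C = {0}" "mod_sum B C = A" and IT: "type_is_IT R A B"
  shows "self_pure_generator R A"
  unfolding self_pure_generator_def
proof (intro allI impI)
  fix S assume S: "pure_sub R A S"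
  then have SR: "Rsubmod R S" and SA: "S \<subseteq> A" by (auto simp: pure_sub_def)
  obtain b where b: "b \<in> B" "b \<noteq> 0" "\<And>x. x \<in> B \<Longrightarrow> \<exists>t. x = sc t b" using B(3) by (rule has_rank_1E) blast
  obtain \<phi> where \<phi>: "\<And>u v. \<phi> (u + v) = \<phi> u + \<phi> v" "\<And>t v. \<phi> (sc t v) = t * \<phi> v"
    "\<phi> b = 1" "\<And>c. c \<in> C \<Longrightarrow> \<phi> c = 0"
    by (rule splitting_functional[OF B(1) C BC(1) b(1,2)]) blast
  define X where "X = {t. sc t b \<in> B}"
  have \<phi>A: "\<phi> a \<in> X" if a: "a \<in> A" for a
  proof -
    obtain u c where "a = u + c" "u \<in> B" "c \<in> C" using a BC(2) by (auto simp: mod_sum_def)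
    moreover from this obtain t where "u = sc t b" using b by blast
    ultimately show ?thesis by (simp add: \<phi> X_def)
  qed
  show "A_generated R A S"
  proof (rule A_generatedI[OF A SR])
    fix s assume s: "s \<in> S"
    define Y where "Y = {t. sc t s \<in> A}"
    obtain k where k: "k \<noteq> 0" "\<forall>t\<in>X. sc (k * t) s \<in> A"
      using type_is_IT_below[OF A B(1) b(1,2) IT, of s] s SA unfolding X_def by blast
    have "1 \<in> ideal_mult (colon Y X) X"
    proof (rule one_mem_colon_mult)
      show "Kmod R X" "Kmod R Y"
        unfolding X_def Y_def using Kmod_coordinates A B(1) by auto
      show "1 \<in> X" "1 \<in> Y" unfolding X_def Y_def using b s SA by auto
      show "k \<in> colon Y X" unfolding Y_def using k by (auto intro: colonI)
    qed (use k in auto)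
    then obtain n c x where cx: "1 = (\<Sum>i<(n::nat). c i * x i)" "\<forall>i<n. c i \<in> colon Y X \<and> x i \<in> X"
      unfolding ideal_mult_def by blast
    define h where "h i v = sc (c i * \<phi> v) s" for i v
    have "rhom R A S (h i)" if i: "i < n" for i
      unfolding rhom_def
    proof (intro conjI ballI)
      fix v assume v: "v \<in> A"
      have "c i * \<phi> v \<in> Y" using cx(2) i \<phi>A[OF v] by (auto dest: colonD)
      then show "h i v \<in> S"
        unfolding h_def Y_def using pure_sub_scale[OF S s] by blast
    qed (simp_all add: h_def \<phi> algebra_simps vs.scale_left_distrib)
    moreover have "sc (x i) b \<in> A" if "i < n" for i using cx(2) that B(2) by (auto simp: X_def)
    moreover have "s = (\<Sum>i<n. h i (sc (x i) b))"
    proof -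
      have "s = sc (\<Sum>i<n. c i * x i) s" by (simp flip: cx(1))
      also have "\<dots> = (\<Sum>i<n. h i (sc (x i) b))" by (simp add: vs.scale_sum_left h_def \<phi>)
      finally show ?thesis .
    qed
    ultimately show "\<exists>n h a. (\<forall>i<(n::nat). rhom R A S (h i) \<and> a i \<in> A) \<and> s = (\<Sum>i<n. h i (a i))"
      by (intro exI[of _ n] exI[of _ h] exI[of _ "\<lambda>i. sc (x i) b"]) blast
  qed
qed

text \<open>Projection along \<open>C\<close> gives a functional \<open>\<phi>\<close>. Its image on
  \<open>A\<close> is, up to a nonzero multiplier, contained in the coordinates of \<open>B\<close>,
  so the inner type of \<open>B\<close> yields the bound that \<open>baer_splitting\<close> needs.
  The new summand is the hull of the vector \<open>v\<close> found there, with the kernel of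
  \<open>\<phi>\<close> as complement.\<close>

lemma quasi_summand_imp_summand:
  fixes A B' C :: "('n::finite \<Rightarrow> 'k) set"
  assumes A: "Rsubmod R A" and B: "Rsubmod R B" "has_rank B 1" and B': "Rsubmod R B'" "B' \<subseteq> A"
    and C: "Rsubmod R C" "C \<subseteq> A" and B'C: "B' \<inter> C = {0}" "quasi_equal R (mod_sum B' C) A"
    and iso: "quasi_iso R B B'" and IT: "type_is_IT R A B"
  shows "\<exists>B C. Rsubmod R B \<and> Rsubmod R C \<and> B \<subseteq> A \<and> C \<subseteq> A \<and> B \<inter> C = {0} \<and>
               mod_sum B C = A \<and> has_rank B 1 \<and> type_is_IT R A B"
proof -
  note Ac = Rsubmod_closed[OF A]
  obtain b where b: "b \<in> B" "b \<noteq> 0" "\<And>x. x \<in> B \<Longrightarrow> \<exists>t. x = sc t b" using B(2) by (rule has_rank_1E) blast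
  obtain f where f: "rhom R B B' f" "inj_on f B" and "quasi_equal R (f ` B) B'"
    using iso unfolding quasi_iso_def by blast
  then obtain r where r: "r \<in> R" "r \<noteq> 0" "sc r ` B' \<subseteq> f ` B"
    unfolding quasi_equal_def by metis
  define b' where "b' = f b"
  have b': "b' \<in> B'" "b' \<noteq> 0"
    using f(1) b(1) inj_onD[OF f(2), of b 0] b(2) Rsubmod_closed(1)[OF B(1)] rhom_zero[OF f(1) B(1)]
    unfolding b'_def rhom_def by metis+
  have B'_multiple: "\<exists>t. sc r x = sc t b' \<and> sc t b \<in> B" if "x \<in> B'" for x
  proof -
    have "sc r x \<in> f ` B" using r(3) that by blast
    then obtain y where y: "y \<in> B" "sc r x = f y" by blast
    obtain t where t: "y = sc t b" using b(3)[OF y(1)] by blast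
    have "sc r x = sc t b'" using rhom_scale[OF f(1) b(1), of t] y t unfolding b'_def by metis
    then show ?thesis using y(1) t by blast
  qed
  obtain \<phi> where \<phi>: "\<And>u v. \<phi> (u + v) = \<phi> u + \<phi> v" "\<And>t v. \<phi> (sc t v) = t * \<phi> v"
    "\<phi> b' = 1" "\<And>c. c \<in> C \<Longrightarrow> \<phi> c = 0"
    by (rule splitting_functional[OF B'(1) C(1) B'C(1) b']) blast
  obtain p where p: "p \<in> R" "p \<noteq> 0" "sc p ` A \<subseteq> mod_sum B' C"
    using B'C(2) unfolding quasi_equal_def by metis
  \<comment> \<open>The factor \<open>p\<close> moves \<open>A\<close> into \<open>B' + C\<close>,
    and \<open>r\<close> moves \<open>B'\<close> into the image of \<open>B\<close>.\<close>
  have \<phi>A: "sc (r * p * \<phi> a) b \<in> B" if a: "a \<in> A" for a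
  proof -
    obtain u c where uc: "sc p a = u + c" "u \<in> B'" "c \<in> C" using a p(3) by (auto simp: mod_sum_def)
    obtain t where t: "sc r u = sc t b'" "sc t b \<in> B" using B'_multiple[OF uc(2)] by blast
    have "r * p * \<phi> a = r * \<phi> (u + c)" by (simp add: \<phi> flip: uc(1))
    also have "\<dots> = \<phi> (sc r u)" using uc by (simp add: \<phi>)
    also have "\<dots> = t" unfolding t(1) by (simp add: \<phi>)
    finally show ?thesis using t by simp
  qed
  have "\<exists>k. k \<noteq> 0 \<and> (\<forall>t\<in>\<phi> ` A. sc (k * t) a \<in> A)" if a: "a \<in> A" for a
  proof -
    obtain k where k: "k \<noteq> 0" "\<forall>t\<in>{t. sc t b \<in> B}. sc (k * t) a \<in> A"
      using type_is_IT_below[OF A B(1) b(1,2) IT a] by blast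
    have "\<forall>t\<in>\<phi> ` A. sc (k * r * p * t) a \<in> A" using k(2) \<phi>A by (auto simp: mult.assoc)
    then show ?thesis using k r p by (intro exI[of _ "k * r * p"]) auto
  qed
  note below = this
  obtain v where v: "\<phi> v = 1" "\<And>t. t \<in> \<phi> ` A \<Longrightarrow> sc t v \<in> A"
    using baer_splitting[OF A \<phi>(1,2) _ _ below, of b'] \<phi>(3) b' B'(2) by auto
  have "1 \<in> \<phi> ` A" using \<phi>(3) b' B'(2) by force
  then have vA: "v \<in> A" using v(2)[of 1] by simp
  have v0: "v \<noteq> 0" using v(1) \<phi>(2)[of 0 0] by auto
  note hull = pure_hull_singleton(1)[OF A vA]
  define K where "K = {a \<in> A. \<phi> a = 0}"
  have K: "Rsubmod R K" "K \<subseteq> A" unfolding K_def Rsubmod_def using Ac \<phi> \<phi>(2)[of 0 0] by auto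
  have inter: "pure_hull R A {v} \<inter> K = {0}"
    unfolding hull K_def using \<phi> v Ac(1) \<phi>(2)[of 0 0] by (auto intro: exI[of _ 0])
  have sum: "mod_sum (pure_hull R A {v}) K = A"
  proof (intro equalityI subsetI)
    fix a assume a: "a \<in> A"
    have "sc (\<phi> a) v \<in> A" using v a by blast
    moreover have "\<phi> (a - sc (\<phi> a) v) + \<phi> a = \<phi> a"
      using \<phi>(1)[of "a - sc (\<phi> a) v" "sc (\<phi> a) v"] by (simp add: \<phi> v)
    ultimately have "a - sc (\<phi> a) v \<in> K" "sc (\<phi> a) v \<in> pure_hull R A {v}"
      using Ac a by (auto simp: K_def hull)
    moreover have "a = sc (\<phi> a) v + (a - sc (\<phi> a) v)" by simp
    ultimately show "a \<in> mod_sum (pure_hull R A {v}) K" unfolding mod_sum_def by blast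
  qed (auto simp: mod_sum_def hull K_def intro: Ac)
  obtain xs where xs: "max_indep_system A xs" by (rule max_indep_system_exists)
  have "type_is_IT R A (pure_hull R A {v})"
  proof (rule type_is_IT_hullI[OF A vA v0 xs])
    fix x assume "x \<in> set xs"
    then have "x \<in> A" using xs by (auto simp: max_indep_system_def)
    from below[OF this] obtain k where k: "k \<noteq> 0" "\<forall>t\<in>\<phi> ` A. sc (k * t) x \<in> A" by blast
    \<comment> \<open>Applying \<open>\<phi>\<close> to \<open>t v\<close> recovers
      \<open>t\<close>, so the multiples of \<open>v\<close> in \<open>A\<close> are those with
      coefficient in \<open>\<phi>(A)\<close>.\<close>
    have "t \<in> \<phi> ` A" if "sc t v \<in> A" for t
      using that v(1) by (intro image_eqI[of _ _ "sc t v"]) (auto simp: \<phi>)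
    then show "type_below A v x" unfolding type_below_def using k by blast
  qed
  then show ?thesis
    using pure_hull_facts[OF A vA] v0 K inter sum by blast
qed

section \<open>Retracts onto pure submodules of rank one\<close>

lemma rhom_pure_hull_comp:
  assumes A: "Rsubmod R A" and y: "y \<in> A" and z: "z \<in> A"
    and h: "rhom R A (pure_hull R A {y}) h" and g: "rhom R A (pure_hull R A {z}) g" "g y \<noteq> 0"
    and x: "x \<in> A" "h x \<noteq> 0"
  shows "rhom R A (pure_hull R A {z}) (g \<circ> h)" "(g \<circ> h) x \<noteq> 0"
proof -
  note hull = pure_hull_singleton(1)[OF A y]
  show "rhom R A (pure_hull R A {z}) (g \<circ> h)"
    using h g(1) pure_hull_facts(2)[OF A y] unfolding rhom_def by (auto simp: subset_iff)
  obtain q where q: "h x = sc q y" "h x \<in> A" using h x unfolding rhom_def hull by blast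
  have "q \<noteq> 0" using q x by auto
  then show "(g \<circ> h) x \<noteq> 0" using rhom_scale[OF g(1) y, of q] q g(2) by simp
qed

text \<open>The vectors having a nonzero multiple in \<open>A\<close> that \<open>h\<close>
  annihilates form a subspace; on \<open>A\<close> itself the multiple can be cancelled.\<close>

lemma rhom_vanishes_on_span:
  assumes A: "Rsubmod R A" and h: "rhom R A B h"
    and S: "S \<subseteq> A" "\<And>x. x \<in> S \<Longrightarrow> h x = 0" and a: "a \<in> A" "a \<in> vs.span S"
  shows "h a = 0"
proof -
  note Ac = Rsubmod_closed[OF A] and Rc = subring_R
  define U where "U = {v. \<exists>d\<in>R. d \<noteq> 0 \<and> sc d v \<in> A \<and> h (sc d v) = 0}"
  have hsc: "h (sc r x) = sc r (h x)" if "r \<in> R" "x \<in> A" for r x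
    using h that by (auto simp: rhom_def)
  have "vs.subspace U"
  proof (rule vs.subspaceI)
    show "0 \<in> U" unfolding U_def using Rc(2) Ac(1) rhom_zero[OF h A] by (auto intro: bexI[of _ 1])
  next
    fix x y assume "x \<in> U" "y \<in> U"
    then obtain k l where kl: "k \<in> R" "k \<noteq> 0" "sc k x \<in> A" "h (sc k x) = 0"
      "l \<in> R" "l \<noteq> 0" "sc l y \<in> A" "h (sc l y) = 0"
      unfolding U_def by blast
    have eq: "sc (k * l) (x + y) = sc l (sc k x) + sc k (sc l y)"
      by (simp add: vs.scale_right_distrib mult.commute)
    have in_A: "sc l (sc k x) \<in> A" "sc k (sc l y) \<in> A"
      using kl by (auto intro: Ac(3) simp del: vs.scale_scale)
    have "h (sc l (sc k x) + sc k (sc l y)) = h (sc l (sc k x)) + h (sc k (sc l y))"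
      using h in_A unfolding rhom_def by blast
    also have "\<dots> = 0" using kl hsc[of l "sc k x"] hsc[of k "sc l y"] by simp
    finally have "sc (k * l) (x + y) \<in> A \<and> h (sc (k * l) (x + y)) = 0"
      unfolding eq using in_A Ac(2) by blast
    then show "x + y \<in> U"
      unfolding U_def using kl Rc(5) by (intro CollectI bexI[of _ "k * l"]) auto
  next
    fix c x assume "x \<in> U"
    then obtain k where k: "k \<in> R" "k \<noteq> 0" "sc k x \<in> A" "h (sc k x) = 0"
      unfolding U_def by blast
    obtain m d where md: "m \<in> R" "d \<in> R" "d \<noteq> 0" "c = m / d" by (rule fraction)
    have eq: "sc (d * k) (sc c x) = sc m (sc k x)" using md by (simp add: ac_simps)
    have "h (sc m (sc k x)) = 0" using hsc[of m "sc k x"] k md by simp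
    moreover have "sc m (sc k x) \<in> A" using k md Ac(3) by blast
    ultimately have "sc (d * k) (sc c x) \<in> A \<and> h (sc (d * k) (sc c x)) = 0"
      unfolding eq by blast
    then show "sc c x \<in> U"
      unfolding U_def using k md(2,3) Rc(5) by (intro CollectI bexI[of _ "d * k"]) auto
  qed
  moreover have "S \<subseteq> U" unfolding U_def using S Rc(2) by (auto intro!: bexI[of _ 1])
  ultimately have "vs.span S \<subseteq> U" by (intro vs.span_minimal)
  then obtain d where "d \<in> R" "d \<noteq> 0" "h (sc d a) = 0" using a unfolding U_def by blast
  then show ?thesis using hsc[of d a] a by simp
qed

text \<open>Without a retract below \<open>x\<close> one could continue forever: a map
  \<open>h\<close> into the hull of the current element \<open>w\<close> kills \<open>w\<close> and
  all earlier elements \<open>Z\<close>, since a nonzero value at one of them would make it a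
  retract, directly or after composition. An element not killed by \<open>h\<close> is therefore
  outside their span, which contradicts finite dimension.\<close>

lemma retract_below_exists:
  fixes A :: "('n::finite \<Rightarrow> 'k) set"
  assumes A: "Rsubmod R A"
    and homs: "\<And>y. y \<in> A \<Longrightarrow> y \<noteq> 0 \<Longrightarrow> \<exists>h. rhom R A (pure_hull R A {y}) h \<and> (\<exists>a\<in>A. h a \<noteq> 0)"
    and x: "x \<in> A" "x \<noteq> 0"
  obtains y where "retract R A y" "type_below A y x"
proof (rule ccontr)
  assume "\<not> thesis"
  then have none: "\<And>y. type_below A y x \<Longrightarrow> \<not> retract R A y" using that by blast
  \<comment> \<open>\<open>Z\<close> holds the elements already passed and \<open>w\<close> the
    current one. Every earlier \<open>z\<close> keeps a map into its hull that does not kill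
    \<open>w\<close>, so that composition is available.\<close>
  have chain: "\<exists>Z w. finite Z \<and> card Z = n \<and> Z \<subseteq> A \<and> w \<in> A \<and> w \<notin> Z \<and> vs.independent (insert w Z) \<and>
      type_below A w x \<and>
      (\<forall>z\<in>Z. type_below A z x \<and> (\<exists>g. rhom R A (pure_hull R A {z}) g \<and> g w \<noteq> 0))" for n
  proof (induction n)
    case 0
    show ?case using x type_below_refl by (intro exI[of _ "{}"] exI[of _ x]) auto
  next
    case (Suc n)
    then obtain Z w where Z: "finite Z" "card Z = n" "Z \<subseteq> A" "w \<in> A" "w \<notin> Z" "vs.independent (insert w Z)"
      "type_below A w x"
      and g: "\<And>z. z \<in> Z \<Longrightarrow> type_below A z x \<and> (\<exists>g. rhom R A (pure_hull R A {z}) g \<and> g w \<noteq> 0)"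
      by blast
    have "w \<noteq> 0" using Z(6) vs.dependent_zero[of "insert w Z"] by auto
    then obtain h w' where h: "rhom R A (pure_hull R A {w}) h" and w': "w' \<in> A" "h w' \<noteq> 0"
      using homs Z(4) by blast
    have "h z = 0" if "z \<in> insert w Z" for z
    proof (rule ccontr)
      assume hz: "h z \<noteq> 0"
      have "retract R A z"
      proof (cases "z = w")
        case True
        then show ?thesis unfolding retract_def using h hz Z(4) by blast
      next
        case False
        then have zZ: "z \<in> Z" using that by blast
        then obtain g' where g': "rhom R A (pure_hull R A {z}) g'" "g' w \<noteq> 0" using g by blast
        have "z \<in> A" using zZ Z(3) by blast
        then show ?thesis
          unfolding retract_def using rhom_pure_hull_comp[OF A Z(4) _ h g' _ hz] by blast
      qed
      moreover have "type_below A z x" using that Z(7) g by blast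
      ultimately show False using none by blast
    qed
    then have w'_span: "w' \<notin> vs.span (insert w Z)"
      using rhom_vanishes_on_span[OF A h, of "insert w Z" w'] Z w' by blast
    have "type_below A w' w" by (rule rhom_pure_hull_below[OF A Z(4) h w'])
    then have w'x: "type_below A w' x" using Z(7) type_below_trans by blast
    have "\<exists>g. rhom R A (pure_hull R A {z}) g \<and> g w' \<noteq> 0" if "z \<in> insert w Z" for z
    proof (cases "z = w")
      case True
      then show ?thesis using h w' by blast
    next
      case False
      then have zZ: "z \<in> Z" using that by blast
      then obtain g' where g': "rhom R A (pure_hull R A {z}) g'" "g' w \<noteq> 0" using g by blast
      have "z \<in> A" using zZ Z(3) by blast
      then show ?thesis using rhom_pure_hull_comp[OF A Z(4) _ h g' w'] by blast
    qed
    then have "\<forall>z\<in>insert w Z. type_below A z x \<and> (\<exists>g. rhom R A (pure_hull R A {z}) g \<and> g w' \<noteq> 0)"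
      using g Z(7) by blast
    moreover have "w' \<notin> insert w Z" using w'_span vs.span_base by blast
    moreover have "vs.independent (insert w' (insert w Z))"
      using w'_span Z(6) by (rule vs.independent_insertI)
    moreover have "finite (insert w Z)" "card (insert w Z) = Suc n" "insert w Z \<subseteq> A"
      using Z by simp_all
    ultimately show ?case
      using w'(1) w'x by (intro exI[of _ "insert w Z"] exI[of _ w'] conjI)
  qed
  obtain Z and w :: "'n \<Rightarrow> 'k" where "finite Z" "card Z = card (UNIV :: 'n set)" "w \<notin> Z" "vs.independent (insert w Z)"
    using chain[of "card (UNIV :: 'n set)"] by (elim exE conjE) (rule that)
  then show False using independent_bound(2)[of "insert w Z"] by simp
qed

lemma retracts_directed:
  fixes A :: "('n::finite \<Rightarrow> 'k) set"
  assumes A: "Rsubmod R A"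
    and homs: "\<And>y. y \<in> A \<Longrightarrow> y \<noteq> 0 \<Longrightarrow> \<exists>h. rhom R A (pure_hull R A {y}) h \<and> (\<exists>a\<in>A. h a \<noteq> 0)"
    and y: "retract R A y" "retract R A z"
  obtains u where "retract R A u" "type_below A u y" "type_below A u z"
proof -
  obtain h g where h: "y \<in> A" "rhom R A (pure_hull R A {y}) h" "h y \<noteq> 0"
    and g: "z \<in> A" "rhom R A (pure_hull R A {z}) g" "g z \<noteq> 0"
    using y unfolding retract_def by blast
  consider "h z \<noteq> 0" | "g y \<noteq> 0" | "h z = 0" "g y = 0" by blast
  then show ?thesis
  proof cases
    case 1
    then have "type_below A z y" by (intro rhom_pure_hull_below[OF A h(1,2) g(1)])
    then show ?thesis using that y type_below_refl by blast
  next
    case 2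
    then have "type_below A y z" by (intro rhom_pure_hull_below[OF A g(1,2) h(1)])
    then show ?thesis using that y type_below_refl by blast
  next
    case 3
    have yz: "y + z \<in> A" using Rsubmod_closed(2)[OF A] h(1) g(1) by blast
    have "h (y + z) = h y + h z" "g (y + z) = g y + g z"
      using h g unfolding rhom_def by blast+
    then have ne: "h (y + z) \<noteq> 0" "g (y + z) \<noteq> 0" using 3 h g by auto
    then have "y + z \<noteq> 0" using rhom_zero[OF h(2) A] by metis
    then obtain u where "retract R A u" "type_below A u (y + z)"
      using retract_below_exists[OF A homs yz] by blast
    moreover have "type_below A (y + z) y" "type_below A (y + z) z"
      using rhom_pure_hull_below[OF A] h g yz ne by blast+
    ultimately show ?thesis using that type_below_trans by blast
  qed
qed

lemma retract_below_finite:
  fixes A :: "('n::finite \<Rightarrow> 'k) set"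
  assumes A: "Rsubmod R A"
    and homs: "\<And>y. y \<in> A \<Longrightarrow> y \<noteq> 0 \<Longrightarrow> \<exists>h. rhom R A (pure_hull R A {y}) h \<and> (\<exists>a\<in>A. h a \<noteq> 0)"
    and F: "finite F" "F \<noteq> {}" "F \<subseteq> A - {0}"
  shows "\<exists>y. retract R A y \<and> (\<forall>x\<in>F. type_below A y x)"
  using F
proof (induction F rule: finite_ne_induct)
  case (singleton x)
  then have "x \<in> A" "x \<noteq> 0" by blast+
  then show ?case using retract_below_exists[OF A homs] by blast
next
  case (insert x F)
  then obtain y where y: "retract R A y" "\<forall>x\<in>F. type_below A y x" by auto
  obtain z where z: "retract R A z" "type_below A z x"
    using retract_below_exists[OF A homs] insert.prems by blast
  obtain u where "retract R A u" "type_below A u y" "type_below A u z"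
    using retracts_directed[OF A homs y(1) z(1)] by blast
  then show ?case using y z type_below_trans by (metis insertE)
qed

section \<open>From retracts to a quasi-direct summand of inner type\<close>

lemma quasi_equalI:
  assumes "r \<in> R" "r \<noteq> 0" "sc r ` C \<subseteq> A" "s \<in> R" "s \<noteq> 0" "sc s ` A \<subseteq> C"
  shows "quasi_equal R A C"
proof -
  have kspan: "kspan C \<subseteq> kspan A" if "r \<noteq> 0" "sc r ` C \<subseteq> A" for r and A C :: "('n \<Rightarrow> 'k) set"
  proof
    fix v assume "v \<in> kspan C"
    then obtain n c x where *: "v = (\<Sum>i<(n::nat). sc (c i) (x i))" "\<forall>i<n. x i \<in> C"
      unfolding kspan_def by blast
    have "v = (\<Sum>i<n. sc (c i / r) (sc r (x i)))" using * that by simp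
    moreover have "\<forall>i<n. sc r (x i) \<in> A" using * that by blast
    ultimately show "v \<in> kspan A"
      unfolding kspan_def by (intro CollectI exI[of _ n] exI[of _ "\<lambda>i. c i / r"] exI[of _ "\<lambda>i. sc r (x i)"] conjI)
  qed
  show ?thesis unfolding quasi_equal_def using assms kspan[of r C A] kspan[of s A C] by blast
qed

text \<open>Take a retract \<open>y\<close> whose type is below those of a maximal independent
  system, with its map \<open>h\<close>. Then \<open>B = B'\<close> is the pure submodule generated
  by \<open>y\<close>, and \<open>C\<close> is the kernel of \<open>h\<close>.\<close>

lemma rank_1_generated_imp_quasi_summand:
  fixes A :: "('n::finite \<Rightarrow> 'k) set"
  assumes A: "Rsubmod R A" "A \<noteq> {0}"
    and gen: "\<And>S. pure_sub R A S \<Longrightarrow> has_rank S 1 \<Longrightarrow> A_generated R A S"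
  shows "\<exists>(B::('n \<Rightarrow> 'k) set) B' C. Rsubmod R B \<and> has_rank B 1 \<and>
               Rsubmod R B' \<and> Rsubmod R C \<and> B' \<subseteq> A \<and> C \<subseteq> A \<and> B' \<inter> C = {0} \<and>
               quasi_equal R (mod_sum B' C) A \<and> quasi_iso R B B' \<and> type_is_IT R A B"
proof -
  note Ac = Rsubmod_closed[OF A(1)] and Rc = subring_R
  have homs: "\<exists>h. rhom R A (pure_hull R A {y}) h \<and> (\<exists>a\<in>A. h a \<noteq> 0)" if y: "y \<in> A" "y \<noteq> 0" for y
  proof -
    have "A_generated R A (pure_hull R A {y})"
      using gen pure_hull_singleton(2)[OF A(1) y(1)] pure_hull_facts(4)[OF A(1) y] by blast
    then obtain H where H: "\<forall>h\<in>H. rhom R A (pure_hull R A {y}) h"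
      "pure_hull R A {y} = {(\<Sum>h\<in>F. h (a h)) | F a. finite F \<and> F \<subseteq> H \<and> (\<forall>h\<in>F. a h \<in> A)}"
      unfolding A_generated_def by blast
    have "y \<in> pure_hull R A {y}" by (rule pure_hull_facts(1)[OF A(1) y(1)])
    then obtain F a where F: "y = (\<Sum>h\<in>F. h (a h))" "F \<subseteq> H" "\<forall>h\<in>F. a h \<in> A"
      using H(2) by blast
    obtain h where "h \<in> F" "h (a h) \<noteq> 0" using F(1) y(2) sum.neutral[of F "\<lambda>h. h (a h)"] by blast
    then show ?thesis using F H(1) by (intro exI[of _ h]) blast
  qed
  obtain xs where xs: "max_indep_system A xs" by (rule max_indep_system_exists)
  have xs_ne: "set xs \<noteq> {}"
    using max_indep_system_span[OF xs] A(2) Ac(1) by auto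
  have xs_A: "set xs \<subseteq> A - {0}"
    using xs vs.dependent_zero[of "set xs"] by (auto simp: max_indep_system_def indep_iff)
  obtain y where y: "retract R A y" "\<forall>x\<in>set xs. type_below A y x"
    using retract_below_finite[OF A(1) homs _ xs_ne xs_A] by blast
  then obtain h where h: "y \<in> A" "rhom R A (pure_hull R A {y}) h" "h y \<noteq> 0"
    unfolding retract_def by blast
  have y0: "y \<noteq> 0" using h rhom_zero[OF h(2) A(1)] by auto
  define B where "B = pure_hull R A {y}"
  define C where "C = {a \<in> A. h a = 0}"
  note B_eq = pure_hull_singleton(1)[OF A(1) h(1), folded B_def]
  note B = pure_hull_facts[OF A(1) h(1), folded B_def]
  have hB: "rhom R A B h" using h(2) B_def by simp
  have hadd: "h (u + v) = h u + h v" if "u \<in> A" "v \<in> A" for u v using hB that by (auto simp: rhom_def)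
  have hsc: "h (sc r u) = sc r (h u)" if "r \<in> R" "u \<in> A" for r u using hB that by (auto simp: rhom_def)
  have C: "Rsubmod R C" "C \<subseteq> A"
    unfolding C_def Rsubmod_def using Ac rhom_zero[OF h(2) A(1)] by (auto simp: hadd hsc)
  have inter: "B \<inter> C = {0}"
  proof (intro equalityI subsetI)
    fix v assume "v \<in> B \<inter> C"
    then obtain t where "v \<in> A" "v = sc t y" "h v = 0" unfolding B_eq C_def by blast
    then show "v \<in> {0}" using rhom_scale[OF h(2,1), of t] h(3) by auto
  qed (use B Rsubmod_closed(1) C in auto)
  obtain q where q: "h y = sc q y" using hB h(1) unfolding rhom_def B_eq by blast
  then have "q \<noteq> 0" using h(3) by auto
  \<comment> \<open>On \<open>B\<close> the map \<open>h\<close> is multiplication by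
    \<open>q = m / d\<close>. Therefore \<open>m a - d h(a)\<close> is killed by \<open>h\<close>,
    and \<open>m a\<close> splits as \<open>d h(a)\<close> plus an element of
    \<open>C\<close>.\<close>
  obtain m d where md: "m \<in> R" "d \<in> R" "d \<noteq> 0" "q = m / d" by (rule fraction)
  have m0: "m \<noteq> 0" using md \<open>q \<noteq> 0\<close> by auto
  have "sc m ` A \<subseteq> mod_sum B C"
  proof
    fix v assume "v \<in> sc m ` A"
    then obtain a where a: "a \<in> A" "v = sc m a" by blast
    obtain t where t: "h a = sc t y" "h a \<in> B" "h a \<in> A" using hB a unfolding rhom_def B_eq by blast
    have dB: "sc d (h a) \<in> B" using Rsubmod_closed(3)[OF B(3) md(2) t(2)] .
    then have dA: "sc d (h a) \<in> A" using B(2) by blast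
    have mA: "sc m a \<in> A" using Ac(3) a md by blast
    have "h (h a) = sc (t * q) y" using rhom_scale[OF h(2,1), of t] t q by simp
    then have "h (sc d (h a)) = sc m (h a)" using hsc[OF md(2) t(3)] t(1) md by (simp add: ac_simps)
    also have "\<dots> = h (sc m a)" using hsc[OF md(1) a(1)] by simp
    finally have "h (sc m a - sc d (h a)) = 0"
      using hadd[of "sc m a - sc d (h a)" "sc d (h a)"] Ac(4)[OF mA dA] dA by simp
    then have "sc m a - sc d (h a) \<in> C" unfolding C_def using Ac(4)[OF mA dA] by blast
    moreover have "v = sc d (h a) + (sc m a - sc d (h a))" using a by simp
    ultimately show "v \<in> mod_sum B C" unfolding mod_sum_def using dB by blast
  qed
  moreover have "sc 1 ` mod_sum B C \<subseteq> A"
    using B(2) C(2) Ac(2) by (auto simp: mod_sum_def)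
  ultimately have "quasi_equal R (mod_sum B C) A"
    using quasi_equalI[of m A "mod_sum B C" 1] md m0 Rc(2) by auto
  moreover have "quasi_iso R B B"
    unfolding quasi_iso_def using Rc(2)
    by (intro exI[of _ id]) (auto simp: rhom_def intro!: quasi_equalI[of 1 _ _ 1])
  moreover have "type_is_IT R A B"
    unfolding B_def using y(2) by (intro type_is_IT_hullI[OF A(1) h(1) y0 xs]) blast
  ultimately show ?thesis using B y0 C inter by blast
qed

end

section \<open>The cycle of implications (a) to (b) to (c) to (d) to (a)\<close>

theorem theorem2p4:
  fixes R :: "'k::field set" and A :: "('n::finite \<Rightarrow> 'k) set"
  assumes "dedekind_domain R"
    and "Rsubmod R A"
    and "A \<noteq> {0}"
  shows "(self_pure_generator R A \<longleftrightarrow>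
            (\<forall>S. pure_sub R A S \<and> has_rank S 1 \<longrightarrow> A_generated R A S))
       \<and> (self_pure_generator R A \<longleftrightarrow>
            (\<exists>(B::('n \<Rightarrow> 'k) set) B' C. Rsubmod R B \<and> has_rank B 1 \<and>
               Rsubmod R B' \<and> Rsubmod R C \<and> B' \<subseteq> A \<and> C \<subseteq> A \<and> B' \<inter> C = {0} \<and>
               quasi_equal R (mod_sum B' C) A \<and> quasi_iso R B B' \<and> type_is_IT R A B))
       \<and> (self_pure_generator R A \<longleftrightarrow>
            (\<exists>B C. Rsubmod R B \<and> Rsubmod R C \<and> B \<subseteq> A \<and> C \<subseteq> A \<and> B \<inter> C = {0} \<and>
               mod_sum B C = A \<and> has_rank B 1 \<and> type_is_IT R A B))"
    (is "(?a \<longleftrightarrow> ?b) \<and> (_ \<longleftrightarrow> ?c) \<and> (_ \<longleftrightarrow> ?d)")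
proof -
  have "?a \<Longrightarrow> ?b" by (simp add: self_pure_generator_def)
  moreover have "?b \<Longrightarrow> ?c"
    by (rule rank_1_generated_imp_quasi_summand[OF assms]) blast
  moreover have "?d" if ?c
  proof -
    from that obtain B :: "('n \<Rightarrow> 'k) set" and B' C where
      "Rsubmod R B" "has_rank B 1" "Rsubmod R B'" "B' \<subseteq> A" "Rsubmod R C" "C \<subseteq> A"
      "B' \<inter> C = {0}" "quasi_equal R (mod_sum B' C) A" "quasi_iso R B B'" "type_is_IT R A B"
      by blast
    then show ?d by (rule quasi_summand_imp_summand[OF assms(1,2)])
  qed
  moreover have "?a" if ?d
  proof -
    from that obtain B C where "Rsubmod R B" "B \<subseteq> A" "has_rank B 1" "Rsubmod R C"
      "B \<inter> C = {0}" "mod_sum B C = A" "type_is_IT R A B"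
      by blast
    then show ?a by (rule summand_imp_self_pure_generator[OF assms(1,2)])
  qed
  ultimately show ?thesis by blast
qed

end
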